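(* Let $V\in L^\infty(\mathbb{R})$ satisfy $0<v_0\le V(x)\le v_1$ for a.e. $x\in\mathbb{R}$, for some constants $v_0,v_1$. Then the Green function $G$ for the differential operator $L:=-\frac{d^2}{dx^2}+V$ on $\mathbb{R}$ is given by $$G(x,y)=\frac{u_y(x)}{u_y'(y_-)-u_y'(y_+)}=\frac{u_x(y)}{u_x'(x_-)-u_x'(x_+)}\qquad (x,y\in\mathbb{R}).$$
   Context: All function spaces are real-valued, $H^1(\mathbb{R})=W^{1,2}(\mathbb{R})$, and every $u\in H^1(\mathbb{R})$ is identified with its continuous representative. Write $\|u\|_\infty=\|u\|_{L^\infty(\mathbb{R})}$, $(u,v)_V=\int_{\mathbb{R}}(u'v'+Vuv)\,dx$ and $\|u\|_V^2=(u,u)_V$. For $a\in\mathbb{R}$ set $K_a:=\{u\in H^1(\mathbb{R}):\ u(a)=\|u\|_\infty=1\}$, and let $u_a$ be the unique minimizer of $\|u\|_V^2$ over $u\in K_a$ (it exists and is unique). The function $u_a$ has right and left derivatives at $x=a$, denoted $u_a'(a_+)$ and $u_a'(a_-)$ respectively. The Green function of $L$ is the function $G:\mathbb{R}\times\mathbb{R}\to\mathbb{R}$ such that for every $y\in\mathbb{R}$, $G(\cdot,y)\in H^1(\mathbb{R})$ and $L\,G(\cdot,y)=\delta_y$ in $H^{-1}(\mathbb{R})$ (with $\delta_y$ the Dirac delta at $y$), i.e. $(G(\cdot,y),v)_V=v(y)$ for all $v\in H^1(\mathbb{R})$. *)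

theory Defs
  imports "HOL-Analysis.Analysis" "HOL-Probability.Essential_Supremum"
begin

text \<open>Everything is taken with respect to Lebesgue measure on the completed sigma-algebra, so
  that the potential and weak derivatives only need to be Lebesgue measurable.\<close>

definition square_integrable :: "(real \<Rightarrow> real) \<Rightarrow> bool" where
  "square_integrable f \<longleftrightarrow>
     f \<in> borel_measurable lebesgue \<and> integrable lebesgue (\<lambda>x. (f x)\<^sup>2)"

definition locally_integrable :: "(real \<Rightarrow> real) \<Rightarrow> bool" where
  "locally_integrable f \<longleftrightarrow> (\<forall>a b. set_integrable lebesgue {a..b} f)"

definition test_function :: "(real \<Rightarrow> real) \<Rightarrow> bool" where
  "test_function \<phi> \<longleftrightarrow>
     (\<forall>n. (deriv ^^ n) \<phi> differentiable_on UNIV) \<and> compact (closure {x. \<phi> x \<noteq> 0})"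

definition has_weak_derivative :: "(real \<Rightarrow> real) \<Rightarrow> (real \<Rightarrow> real) \<Rightarrow> bool" where
  "has_weak_derivative u g \<longleftrightarrow>
     locally_integrable u \<and> locally_integrable g \<and>
     (\<forall>\<phi>. test_function \<phi> \<longrightarrow>
        (LINT x|lebesgue. u x * deriv \<phi> x) = - (LINT x|lebesgue. g x * \<phi> x))"

text \<open>The weak derivative is determined up to null sets only. An arbitrary representative is
  chosen; it is used only under integrals, which do not depend on the choice.\<close>

definition weak_deriv :: "(real \<Rightarrow> real) \<Rightarrow> real \<Rightarrow> real" where
  "weak_deriv u = (SOME g. has_weak_derivative u g)"

text \<open>The elements of the Sobolev space \<open>H\<^sup>1(\<real>)\<close> are represented by their
  (unique) continuous representatives.\<close>

definition H1 :: "(real \<Rightarrow> real) set" where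
  "H1 = {u. continuous_on UNIV u \<and> square_integrable u \<and>
            (\<exists>g. has_weak_derivative u g \<and> square_integrable g)}"

definition inner_V :: "(real \<Rightarrow> real) \<Rightarrow> (real \<Rightarrow> real) \<Rightarrow> (real \<Rightarrow> real) \<Rightarrow> real" where
  "inner_V V u v = (LINT x|lebesgue. weak_deriv u x * weak_deriv v x + V x * u x * v x)"

definition K :: "real \<Rightarrow> (real \<Rightarrow> real) set" where
  "K a = {u \<in> H1. u a = 1 \<and> esssup lebesgue (\<lambda>x. ereal \<bar>u x\<bar>) = 1}"

text \<open>\<open>minimizer V a\<close> is the function \<open>u\<^sub>a\<close>.\<close>

definition minimizer :: "(real \<Rightarrow> real) \<Rightarrow> real \<Rightarrow> real \<Rightarrow> real" where
  "minimizer V a = (THE u. is_arg_min (\<lambda>w. inner_V V w w) (\<lambda>w. w \<in> K a) u)"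

definition left_deriv :: "(real \<Rightarrow> real) \<Rightarrow> real \<Rightarrow> real" where
  "left_deriv f a = (THE D. (f has_real_derivative D) (at_left a))"

definition right_deriv :: "(real \<Rightarrow> real) \<Rightarrow> real \<Rightarrow> real" where
  "right_deriv f a = (THE D. (f has_real_derivative D) (at_right a))"

text \<open>The equation \<open>L G(\<cdot>, y) = \<delta>\<^sub>y\<close> in \<open>H\<^sup>-\<^sup>1(\<real>)\<close>, where
  \<open>L = - d\<^sup>2/dx\<^sup>2 + V\<close>, is expressed by testing against all of \<open>H\<^sup>1(\<real>)\<close>.\<close>

definition is_green_function :: "(real \<Rightarrow> real) \<Rightarrow> (real \<Rightarrow> real \<Rightarrow> real) \<Rightarrow> bool" where
  "is_green_function V G \<longleftrightarrow>
     (\<forall>y. (\<lambda>x. G x y) \<in> H1 \<and> (\<forall>v\<in>H1. inner_V V (\<lambda>x. G x y) v = v y))"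

definition green_function :: "(real \<Rightarrow> real) \<Rightarrow> real \<Rightarrow> real \<Rightarrow> real" where
  "green_function V = (THE G. is_green_function V G)"

end

theory Submission
  imports Defs
begin

text \<open>Write \<open>G\<^sub>a = G(\<cdot>,a)\<close>. The link between Green function and minimizer is the reproducing property:
  every \<open>w\<close> in \<open>H\<^sup>1\<close> with \<open>w(a) = 1\<close> satisfies \<open>(G\<^sub>a, w)\<^sub>V = 1\<close>, so for \<open>u = G\<^sub>a / G\<^sub>a(a)\<close> Pythagoras gives
  \<open>\<parallel>w\<parallel>\<^sup>2 = \<parallel>u\<parallel>\<^sup>2 + \<parallel>w - u\<parallel>\<^sup>2\<close>. Hence \<open>u\<close> is the unique minimizer over \<open>K\<^sub>a\<close> as soon as
  it lies in \<open>K\<^sub>a\<close>, that is, as soon as \<open>0 \<le> G\<^sub>a \<le> G\<^sub>a(a)\<close> (\<open>norm_green_minimal\<close>, \<open>norm_green_in_K\<close>). This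
  bound is a maximum principle: off \<open>a\<close> the equation says \<open>G\<^sub>a'' = V G\<^sub>a \<ge> 0\<close>, so \<open>G\<^sub>a\<close> is convex on either side
  of \<open>a\<close>, and a bounded convex function on a half-line decreases away from the end point
  (\<open>green_convex\<close>, \<open>green_max\<close>). The derivative of \<open>G\<^sub>a\<close> jumps by \<open>-1\<close> at \<open>a\<close>, so that of \<open>u\<close> jumps by
  \<open>-1 / G\<^sub>a(a)\<close>; dividing \<open>u\<close> by the jump undoes the normalization. The second formula is the symmetry
  of \<open>G\<close>, which, like its uniqueness, comes from evaluating \<open>(G(\<cdot>,y), G(\<cdot>,x))\<^sub>V\<close> in two ways.

  The Green function is constructed by perturbing the constant potential \<open>v\<^sub>1 = m\<^sup>2\<close>, whose fundamental
  solution is \<open>\<Gamma>(z) = exp(-m\<bar>z\<bar>) / (2m)\<close>. The equation for \<open>G\<^sub>y\<close> becomes the fixed-point equation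
  \<open>G\<^sub>y = \<Gamma>(\<cdot> - y) + \<Gamma> * ((v\<^sub>1 - V) G\<^sub>y)\<close>. All its coefficients are nonnegative, so Picard iteration from \<open>0\<close>
  increases to a solution in \<open>[0,\<infinity>]\<close>; and since \<open>\<integral>\<Gamma> = 1/v\<^sub>1\<close>, its increments are dominated by a geometric
  series of ratio \<open>(v\<^sub>1 - v\<^sub>0)/v\<^sub>1 < 1\<close>, in the supremum norm and in \<open>L\<^sup>1\<close> alike. The solution is thus bounded
  and integrable, hence in \<open>L\<^sup>2\<close>, and \<open>\<bar>\<Gamma>'\<bar> \<le> m \<Gamma>\<close> transfers this to its derivative. Fubini's theorem
  carries the reproducing property from \<open>\<Gamma>\<close> (\<open>kern_reproducing\<close>) over to \<open>G\<^sub>y\<close> (\<open>green_reproducing\<close>).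

  Weak derivatives enter only through two bridges to the classical calculus. Testing against smoothed
  indicators of intervals shows that a continuous function is the primitive of its weak derivative
  (\<open>weak_derivative_ftc\<close>), which also makes the weak derivative unique almost everywhere. Conversely,
  integration by parts shows that a continuous function which is differentiable off a finite set has
  its pointwise derivative as weak derivative (\<open>has_weak_derivative_of_derivative\<close>); this covers \<open>\<Gamma>\<close>,
  \<open>G\<^sub>y\<close> and the piecewise linear functions used in the maximum principle.\<close>

section \<open>Smooth step functions\<close>

definition smooth :: "(real \<Rightarrow> real) \<Rightarrow> bool" where
  "smooth f \<longleftrightarrow> (\<forall>n. (deriv ^^ n) f differentiable_on UNIV)"

text \<open>Iterated derivatives of products or of \<open>exp (-1/x)\<close> have no convenient closed form. It is enough to
exhibit a class of functions that is closed under differentiation.\<close>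

lemma smooth_coinduct:
  assumes "f \<in> C"
    and C: "\<And>f. f \<in> C \<Longrightarrow> \<exists>g\<in>C. \<forall>x. (f has_real_derivative g x) (at x)"
  shows "smooth f"
proof -
  have step: "f differentiable_on UNIV \<and> deriv f \<in> C" if "f \<in> C" for f
  proof -
    from C[OF that] obtain g where g: "g \<in> C" "\<And>x. (f has_real_derivative g x) (at x)" by blast
    then have "deriv f = g" by (auto intro!: ext DERIV_imp_deriv)
    moreover have "f differentiable_on UNIV"
      using g(2) by (auto simp: differentiable_on_def real_differentiable_def)
    ultimately show ?thesis using g by simp
  qed
  have "(deriv ^^ n) f \<in> C" for n
    by (induction n) (use \<open>f \<in> C\<close> step in auto)
  then show ?thesis using step by (auto simp: smooth_def)
qed

lemma smooth_deriv: "smooth f \<Longrightarrow> smooth (deriv f)"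
  unfolding smooth_def by (metis comp_apply funpow_Suc_right)

lemma smooth_has_derivative: "smooth f \<Longrightarrow> (f has_real_derivative deriv f x) (at x)"
  unfolding smooth_def
  by (metis DERIV_deriv_iff_real_differentiable UNIV_I differentiable_on_eq_differentiable_at
      funpow_0 open_UNIV)

lemma smooth_isCont: "smooth f \<Longrightarrow> isCont f x"
  using smooth_has_derivative DERIV_isCont by blast

lemma smooth_continuous_on: "smooth f \<Longrightarrow> continuous_on A f"
  by (simp add: continuous_at_imp_continuous_on smooth_isCont)

lemma smooth_antideriv:
  assumes "smooth g" and "\<And>x. (f has_real_derivative g x) (at x)"
  shows "smooth f"
  by (rule smooth_coinduct[of f "{f. \<exists>g. smooth g \<and> (\<forall>x. (f has_real_derivative g x) (at x))}"])
    (use assms smooth_deriv smooth_has_derivative in blast)+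

text \<open>By the Leibniz rule the products of two smooth functions are not closed under differentiation, but
their finite sums are.\<close>

inductive_set sums_of_products :: "(real \<Rightarrow> real) set" where
  product: "smooth f \<Longrightarrow> smooth g \<Longrightarrow> (\<lambda>x. f x * g x) \<in> sums_of_products"
| sum: "f \<in> sums_of_products \<Longrightarrow> g \<in> sums_of_products \<Longrightarrow> (\<lambda>x. f x + g x) \<in> sums_of_products"

lemma smooth_sums_of_products:
  assumes "f \<in> sums_of_products" shows "smooth f"
  using assms
proof (rule smooth_coinduct)
  fix f assume "f \<in> sums_of_products"
  then show "\<exists>g\<in>sums_of_products. \<forall>x. (f has_real_derivative g x) (at x)"
  proof induction
    case (product f g)
    have "(\<lambda>x. deriv f x * g x + f x * deriv g x) \<in> sums_of_products"
      using product by (intro sums_of_products.intros smooth_deriv)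
    moreover have "((\<lambda>x. f x * g x) has_real_derivative deriv f x * g x + f x * deriv g x) (at x)" for x
      using product by (auto intro!: derivative_eq_intros smooth_has_derivative)
    ultimately show ?case by (intro bexI allI)
  next
    case (sum f g)
    then obtain f' g' where "f' \<in> sums_of_products" "g' \<in> sums_of_products"
      and D: "\<And>x. (f has_real_derivative f' x) (at x)" "\<And>x. (g has_real_derivative g' x) (at x)"
      by blast
    then have "(\<lambda>x. f' x + g' x) \<in> sums_of_products" by (intro sums_of_products.intros)
    moreover have "((\<lambda>x. f x + g x) has_real_derivative f' x + g' x) (at x)" for x
      by (intro DERIV_add D)
    ultimately show ?case by (intro bexI allI)
  qed
qed

lemma smooth_mult: "smooth f \<Longrightarrow> smooth g \<Longrightarrow> smooth (\<lambda>x. f x * g x)"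
  by (rule smooth_sums_of_products[OF sums_of_products.product])

lemma smooth_const: "smooth (\<lambda>x. c)"
  by (rule smooth_coinduct[of _ "range (\<lambda>c x. c)"]) (auto intro!: exI[of _ 0])

lemma smooth_affine:
  assumes "smooth f" shows "smooth (\<lambda>x. f (a * x + b))"
proof (rule smooth_coinduct[of _ "{\<lambda>x. c * f (a * x + b) |f c. smooth f}"])
  show "(\<lambda>x. f (a * x + b)) \<in> {\<lambda>x. c * f (a * x + b) |f c. smooth f}"
    using assms by (auto intro!: exI[of _ f] exI[of _ 1])
next
  fix h assume "h \<in> {\<lambda>x. c * f (a * x + b) |f c. smooth f}"
  then obtain f c where f: "smooth f" "h = (\<lambda>x. c * f (a * x + b))" by blast
  let ?h' = "\<lambda>x. (c * a) * deriv f (a * x + b)"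
  have "(h has_real_derivative ?h' x) (at x)" for x
    unfolding f(2) by (auto intro!: derivative_eq_intros DERIV_chain2[OF smooth_has_derivative[OF f(1)]])
  moreover have "?h' \<in> {\<lambda>x. c * f (a * x + b) |f c. smooth f}"
    using smooth_deriv[OF f(1)] by blast
  ultimately show "\<exists>g\<in>{\<lambda>x. c * f (a * x + b) |f c. smooth f}. \<forall>x. (h has_real_derivative g x) (at x)"
    by (intro bexI allI)
qed

lemma smooth_diff: "smooth f \<Longrightarrow> smooth g \<Longrightarrow> smooth (\<lambda>x. f x - g x)"
  using smooth_sums_of_products[OF sums_of_products.sum[OF
    sums_of_products.product[OF _ smooth_const[of 1], of f]
    sums_of_products.product[OF _ smooth_const[of "-1"], of g]]]
  by simp

text \<open>Differentiating \<open>exp (-1/x)\<close> produces polynomials in \<open>1/x\<close> as factors; with an arbitrary polynomial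
\<open>p\<close> the family is closed under differentiation.\<close>

definition flat :: "real poly \<Rightarrow> real \<Rightarrow> real" where
  "flat p x = (if x \<le> 0 then 0 else poly p (1 / x) * exp (- (1 / x)))"

lemma poly_exp_tendsto_0: "((\<lambda>x. poly p x * exp (- x)) \<longlongrightarrow> 0) (at_top :: real filter)"
proof -
  have "((\<lambda>x. \<Sum>i\<le>degree p. coeff p i * (x ^ i * exp (- x))) \<longlongrightarrow> (\<Sum>i\<le>degree p. coeff p i * 0)) (at_top :: real filter)"
  proof (intro tendsto_intros)
    fix i
    show "((\<lambda>x. x ^ i * exp (- x)) \<longlongrightarrow> 0) (at_top :: real filter)"
      using tendsto_power_div_exp_0[of i] by (simp add: exp_minus divide_inverse)
  qed
  then show ?thesis by (simp add: poly_altdef sum_distrib_right mult.assoc)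
qed

text \<open>For positive \<open>x\<close>, the derivative of \<open>p(1/x) exp(-1/x)\<close> is \<open>(1/x)\<^sup>2 (p(1/x) - p'(1/x)) exp(-1/x)\<close>. At the origin the difference
quotient is again of this shape and vanishes in the limit, because exponential decay beats polynomials.\<close>

lemma flat_has_derivative:
  "(flat p has_real_derivative flat ([:0, 0, 1:] * (p - pderiv p)) x) (at x)"
proof -
  consider "x < 0" | "x > 0" | "x = 0" by linarith
  then show ?thesis
  proof cases
    case 1
    have "((\<lambda>x. 0) has_real_derivative 0) (at x)" by simp
    then have "(flat p has_real_derivative 0) (at x)"
      by (rule has_field_derivative_transform_within_open[of _ _ _ "{..<0}"])
         (use 1 in \<open>auto simp: flat_def\<close>)
    then show ?thesis using 1 by (simp add: flat_def)
  next
    case 2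
    have "((\<lambda>x. poly p (1 / x) * exp (- (1 / x))) has_real_derivative
       poly (pderiv p) (1 / x) * (- (1 / x\<^sup>2)) * exp (- (1 / x))
         + poly p (1 / x) * (exp (- (1 / x)) * (1 / x\<^sup>2))) (at x)"
      using 2 by (intro derivative_eq_intros DERIV_chain2[OF poly_DERIV] refl)
        (auto simp: power2_eq_square)
    also have "poly (pderiv p) (1 / x) * (- (1 / x\<^sup>2)) * exp (- (1 / x))
         + poly p (1 / x) * (exp (- (1 / x)) * (1 / x\<^sup>2))
       = flat ([:0, 0, 1:] * (p - pderiv p)) x"
      using 2 by (simp add: flat_def algebra_simps power2_eq_square)
    finally have "((\<lambda>x. poly p (1 / x) * exp (- (1 / x))) has_real_derivative
       flat ([:0, 0, 1:] * (p - pderiv p)) x) (at x)" .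
    then show ?thesis
      by (rule has_field_derivative_transform_within_open[of _ _ _ "{0<..}"])
         (use 2 in \<open>auto simp: flat_def\<close>)
  next
    case 3
    have "((\<lambda>y. flat p y / y) \<longlongrightarrow> 0) (at_left 0)"
      by (rule tendsto_eventually) (auto simp: eventually_at_filter flat_def)
    moreover have "((\<lambda>y. flat p y / y) \<longlongrightarrow> 0) (at_right 0)"
    proof -
      have "((\<lambda>y. poly (pCons 0 p) (inverse y) * exp (- inverse y)) \<longlongrightarrow> 0) (at_right 0)"
        by (rule filterlim_compose[OF poly_exp_tendsto_0 filterlim_inverse_at_top_right])
      moreover have "\<forall>\<^sub>F y in at_right 0. poly (pCons 0 p) (inverse y) * exp (- inverse y) = flat p y / y"
        by (auto simp: eventually_at_filter flat_def divide_inverse)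
      ultimately show ?thesis by (rule Lim_transform_eventually)
    qed
    ultimately have "((\<lambda>y. flat p y / y) \<longlongrightarrow> 0) (at 0)"
      by (simp add: filterlim_split_at_real)
    then show ?thesis using 3 by (simp add: has_field_derivative_iff flat_def)
  qed
qed

lemma smooth_flat: "smooth (flat p)"
  by (rule smooth_coinduct[of _ "range flat"]) (use flat_has_derivative in blast)+

text \<open>Up to normalization, \<open>E\<close> is a primitive of a smooth bump that is positive exactly on \<open>(0,1)\<close>.\<close>

lemma smooth_step_exists:
  "\<exists>E. smooth E \<and> (\<forall>t\<le>0. E t = 0) \<and> (\<forall>t\<ge>1. E t = 1) \<and> (\<forall>t. \<bar>E t\<bar> \<le> 1)"
proof -
  define b where "b = (\<lambda>x. flat 1 x * flat 1 ((- 1) * x + 1))"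
  have b: "smooth b" unfolding b_def by (intro smooth_mult smooth_affine smooth_flat)
  have b0: "b x = 0" if "x \<le> 0 \<or> x \<ge> 1" for x using that by (auto simp: b_def flat_def)
  have bpos: "b x > 0" if "0 < x" "x < 1" for x using that by (auto simp: b_def flat_def)
  have bnn: "b x \<ge> 0" for x using b0[of x] bpos[of x] by force
  obtain F where F: "\<And>x. (F has_real_derivative b x) (at x)"
    using einterval_antiderivative[of "-\<infinity>" "\<infinity>" b] smooth_isCont[OF b]
    by (auto simp: has_real_derivative_iff_has_vector_derivative)
  have mono: "F x \<le> F y" if "x \<le> y" for x y
    by (rule DERIV_nonneg_imp_nondecreasing[OF that]) (use F bnn in blast)
  have lt: "F 0 < F 1"
  proof -
    from MVT2[OF zero_less_one F] obtain z where "0 < z" "z < 1" "F 1 - F 0 = (1 - 0) * b z"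
      by blast
    then show ?thesis using bpos[of z] by simp
  qed
  have F0: "F t = F 0" if "t \<le> 0" for t
  proof (cases "t = 0")
    case False
    with that have "t < 0" by simp
    from MVT2[OF this F] obtain z where "z < 0" "F 0 - F t = (0 - t) * b z" by blast
    then show ?thesis using b0[of z] by simp
  qed simp
  have F1: "F t = F 1" if "t \<ge> 1" for t
  proof (cases "t = 1")
    case False
    with that have "t > 1" by simp
    from MVT2[OF this F] obtain z where "z > 1" "F t - F 1 = (t - 1) * b z" by blast
    then show ?thesis using b0[of z] by simp
  qed simp
  define E where "E = (\<lambda>t. (1 / (F 1 - F 0)) * (F t - F 0))"
  have "smooth E" unfolding E_def
    by (intro smooth_mult smooth_diff smooth_const smooth_antideriv[OF b F])
  moreover have "\<bar>E t\<bar> \<le> 1" for t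
  proof -
    have "F 0 \<le> F t" using F0 mono by (metis linear order_refl)
    moreover have "F t \<le> F 1" using F1 mono by (metis linear order_refl)
    ultimately show ?thesis using lt by (simp add: E_def abs_le_iff field_simps)
  qed
  moreover have "E t = 0" if "t \<le> 0" for t using F0[OF that] by (simp add: E_def)
  moreover have "E t = 1" if "t \<ge> 1" for t using F1[OF that] lt by (simp add: E_def)
  ultimately show ?thesis by blast
qed

section \<open>Continuous functions with a weak derivative are its primitives\<close>

lemma integral_lebesgue_eq_lborel:
  fixes f :: "real \<Rightarrow> real"
  shows "f \<in> borel_measurable borel \<Longrightarrow> integral\<^sup>L lebesgue f = integral\<^sup>L lborel f"
  by (simp add: integral_completion)

lemma integrable_lebesgue_eq_lborel:
  fixes f :: "real \<Rightarrow> real"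
  shows "f \<in> borel_measurable borel \<Longrightarrow> integrable lebesgue f \<longleftrightarrow> integrable lborel f"
  by (simp add: integrable_completion)

lemma lebesgue_measurable_of_borel:
  fixes f :: "real \<Rightarrow> real"
  shows "f \<in> borel_measurable borel \<Longrightarrow> f \<in> borel_measurable lebesgue"
  by (simp add: measurable_completion)

lemma AE_lebesgue_iff_lborel: "(AE x in lebesgue. P x) \<longleftrightarrow> (AE x in lborel. P x)"
  by (rule AE_completion_iff)

lemma locally_integrable_measurable:
  assumes "locally_integrable g" shows "g \<in> borel_measurable lebesgue"
proof (rule borel_measurable_LIMSEQ_real)
  fix n :: nat
  show "(\<lambda>x. indicator {- real n..real n} x * g x) \<in> borel_measurable lebesgue"
  proof -
    have "integrable lebesgue (\<lambda>x. indicator {- real n..real n} x *\<^sub>R g x)"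
      using assms by (simp add: locally_integrable_def set_integrable_def)
    from borel_measurable_integrable[OF this] show ?thesis by simp
  qed
next
  fix x :: real
  obtain m :: nat where m: "\<bar>x\<bar> \<le> real m" using real_arch_simple by blast
  show "(\<lambda>n. indicator {- real n..real n} x * g x) \<longlonglongrightarrow> g x"
  proof (rule tendsto_eventually)
    show "\<forall>\<^sub>F n in sequentially. indicator {- real n..real n} x * g x = g x"
      using eventually_ge_at_top[of m]
    proof eventually_elim
      case (elim n)
      then have "\<bar>x\<bar> \<le> real n" using m by linarith
      then show ?case by (auto simp: indicator_def abs_le_iff)
    qed
  qed
qed

text \<open>Passing from Lebesgue to Borel measurable representatives allows integration against \<open>lborel\<close>, where
product measurability and Fubini's theorem apply directly.\<close>

lemma locally_integrable_borel_version:
  assumes "locally_integrable g"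
  shows "\<exists>g'. g' \<in> borel_measurable borel \<and> (AE x in lborel. g x = g' x) \<and>
    (\<forall>a b. set_integrable lborel {a..b} g')"
proof -
  obtain g' where g': "g' \<in> borel_measurable borel" "AE x in lborel. g x = g' x"
    using completion_ex_borel_measurable_real[OF locally_integrable_measurable[OF assms]] by auto
  have "set_integrable lborel {a..b} g'" for a b
  proof -
    have [measurable]: "g' \<in> borel_measurable lebesgue" "g \<in> borel_measurable lebesgue"
      using g'(1) locally_integrable_measurable[OF assms]
      by (auto intro: lebesgue_measurable_of_borel)
    have "integrable lebesgue (\<lambda>x. indicator {a..b} x *\<^sub>R g x) =
          integrable lebesgue (\<lambda>x. indicator {a..b} x *\<^sub>R g' x)"
    proof (rule integrable_cong_AE)
      show "AE x in lebesgue. indicator {a..b} x *\<^sub>R g x = indicator {a..b} x *\<^sub>R g' x"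
        unfolding AE_lebesgue_iff_lborel using g'(2) by eventually_elim simp
    qed (intro borel_measurable_scaleR borel_measurable_indicator; simp)+
    then show ?thesis using assms g'(1)
      by (simp add: locally_integrable_def set_integrable_def integrable_lebesgue_eq_lborel)
  qed
  then show ?thesis using g' by blast
qed

lemma continuous_compact_support_integrable:
  fixes f :: "real \<Rightarrow> real"
  assumes "continuous_on UNIV f" "\<And>x. x \<notin> {a..b} \<Longrightarrow> f x = 0"
  shows "integrable lborel f"
proof -
  have "set_integrable lborel {a..b} f"
    by (rule borel_integrable_atLeastAtMost') (use assms continuous_on_subset in blast)
  moreover have "(\<lambda>x. indicator {a..b} x *\<^sub>R f x) = f"
    using assms(2) by (intro ext) (metis indicator_simps mult_zero_left mult_1_left mult_zero_right real_scaleR_def)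
  ultimately show ?thesis by (simp add: set_integrable_def)
qed

lemma tendsto_scaled_at_top: "0 < (c::real) \<Longrightarrow> filterlim (\<lambda>n. real (Suc n) * c) at_top sequentially"
  by (rule filterlim_at_top_mult_tendsto_pos[OF tendsto_const _
      filterlim_compose[OF filterlim_real_sequentially filterlim_Suc]])

text \<open>The functions \<open>N E'(N (t - a))\<close> have integral \<open>1\<close> and are supported in \<open>[a, a + 1/N]\<close>. After the
substitution \<open>t = a + s/N\<close> the limit can be taken under the integral.\<close>

lemma mollifier_tendsto:
  fixes u :: "real \<Rightarrow> real"
  assumes u: "continuous_on UNIV u"
    and E: "smooth E" "\<And>t. t \<le> 0 \<Longrightarrow> E t = 0" "\<And>t. t \<ge> 1 \<Longrightarrow> E t = 1"
    and E': "\<And>t. t \<notin> {0..1} \<Longrightarrow> deriv E t = 0"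
  shows "(\<lambda>n. LINT t|lborel. u t * (real (Suc n) * deriv E (real (Suc n) * (t - a)))) \<longlonglongrightarrow> u a"
proof -
  have cE': "continuous_on A (deriv E)" for A by (intro smooth_continuous_on smooth_deriv E)
  have cu: "isCont u x" for x using u by (simp add: continuous_on_eq_continuous_at)
  have [measurable]: "u \<in> borel_measurable borel" "deriv E \<in> borel_measurable borel"
    using u cE' by (auto intro: borel_measurable_continuous_onI)
  have "(LINT t|lborel. u t * (real (Suc n) * deriv E (real (Suc n) * (t - a)))) =
        (LINT s|lborel. u (a + s / real (Suc n)) * deriv E s)" for n
  proof -
    define N where "N = real (Suc n)"
    have "N > 0" by (simp add: N_def)
    then have "(LINT t|lborel. u t * (N * deriv E (N * (t - a)))) =
        (LINT s|lborel. u (a + s / N) * deriv E s)"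
      by (subst lborel_integral_real_affine[of "1 / N" _ a]) (auto simp: mult.left_commute)
    then show ?thesis by (simp only: N_def)
  qed
  moreover have "(\<lambda>n. LINT s|lborel. u (a + s / real (Suc n)) * deriv E s)
      \<longlonglongrightarrow> (LINT s|lborel. u a * deriv E s)"
  proof -
    have "bounded (u ` {a..a+1})" "bounded (deriv E ` {0..1})"
      using continuous_on_subset[OF u, of "{a..a+1}"] cE'
      by (auto intro!: compact_imp_bounded compact_continuous_image)
    then obtain B C where B: "\<And>x. x \<in> {a..a+1} \<Longrightarrow> \<bar>u x\<bar> \<le> B"
      and C: "\<And>x. x \<in> {0..1} \<Longrightarrow> \<bar>deriv E x\<bar> \<le> C"
      unfolding bounded_iff by (metis imageI real_norm_def)
    show ?thesis
    proof (rule integral_dominated_convergence[where w = "\<lambda>s. indicator {0..1} s * (B * C)"])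
      show "integrable lborel (\<lambda>s. indicator {0..1::real} s * (B * C :: real))"
        by (intro integrable_mult_left integrable_real_indicator) auto
      show "AE s in lborel. (\<lambda>n. u (a + s / real (Suc n)) * deriv E s) \<longlonglongrightarrow> u a * deriv E s"
      proof (intro always_eventually allI)
        fix s :: real
        have "(\<lambda>n. a + s / real (Suc n)) \<longlonglongrightarrow> a + 0"
          by (intro tendsto_intros LIMSEQ_Suc lim_const_over_n)
        then have "(\<lambda>n. u (a + s / real (Suc n))) \<longlonglongrightarrow> u a"
          using isCont_tendsto_compose[OF cu[of a]] by simp
        then show "(\<lambda>n. u (a + s / real (Suc n)) * deriv E s) \<longlonglongrightarrow> u a * deriv E s"
          by (intro tendsto_intros)
      qed
      show "AE s in lborel. norm (u (a + s / real (Suc n)) * deriv E s) \<le> indicator {0..1} s * (B * C)" for n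
      proof (intro always_eventually allI)
        fix s
        show "norm (u (a + s / real (Suc n)) * deriv E s) \<le> indicator {0..1} s * (B * C)"
        proof (cases "s \<in> {0..1}")
          case True
          then have "s / real (Suc n) \<le> 1" "0 \<le> s / real (Suc n)" by (auto simp: field_simps)
          then have "\<bar>u (a + s / real (Suc n))\<bar> * \<bar>deriv E s\<bar> \<le> B * C"
            using B[of "a + s / real (Suc n)"] C[OF True] by (intro mult_mono) auto
          then show ?thesis using True by (simp add: abs_mult)
        qed (use E' in auto)
      qed
    qed auto
  qed
  moreover have "(LINT s|lborel. u a * deriv E s) = u a"
  proof -
    have "(LINT s|lborel. deriv E s) = (LINT s|lborel. deriv E s * indicator {0..1} s)"
      using E' by (intro Bochner_Integration.integral_cong) (auto simp: indicator_def)
    also have "\<dots> = E 1 - E 0"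
      by (rule integral_FTC_Icc_real)
        (auto intro: smooth_has_derivative[OF E(1)] smooth_isCont[OF smooth_deriv[OF E(1)]])
    finally show ?thesis using E(2)[of 0] E(3)[of 1] by simp
  qed
  ultimately show ?thesis by (simp only:)
qed

text \<open>The test functions \<open>\<phi>\<^sub>n(t) = E(N(t - a)) - E(N(t - b))\<close> with \<open>N = n + 1\<close> converge boundedly to the
indicator of \<open>(a,b]\<close>, while their derivatives concentrate at \<open>a\<close> (with mass \<open>1\<close>) and at \<open>b\<close> (with
mass \<open>-1\<close>). Passing to the limit in \<open>\<integral>u \<phi>\<^sub>n' = -\<integral>g \<phi>\<^sub>n\<close> gives \<open>u(a) - u(b) = -\<integral>\<^sub>a\<^sup>b g\<close>.\<close>

lemma weak_derivative_ftc:
  assumes u: "continuous_on UNIV u" and w: "has_weak_derivative u g"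
    and g': "g' \<in> borel_measurable borel" "AE x in lborel. g x = g' x"
      "\<And>a b. set_integrable lborel {a..b} g'"
    and "a \<le> b"
  shows "u b - u a = (LINT x:{a..b}|lborel. g' x)"
proof -
  obtain E where E: "smooth E" "\<And>t. t \<le> 0 \<Longrightarrow> E t = 0" "\<And>t. t \<ge> 1 \<Longrightarrow> E t = 1"
    and E1: "\<And>t. \<bar>E t\<bar> \<le> 1"
    using smooth_step_exists by blast
  have E': "deriv E t = 0" if "t \<notin> {0..1}" for t
  proof -
    have "(E has_real_derivative 0) (at t)" if "t < 0"
      by (rule has_field_derivative_transform_within_open[OF DERIV_const, where S = "{..<0}"])
        (use that E(2) in auto)
    moreover have "(E has_real_derivative 0) (at t)" if "t > 1"
      by (rule has_field_derivative_transform_within_open[OF DERIV_const, where S = "{1<..}"])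
        (use that E(3) in auto)
    ultimately show ?thesis using that by (auto intro: DERIV_imp_deriv)
  qed
  let ?N = "\<lambda>n. real (Suc n)"
  define \<phi> where "\<phi> n t = E (?N n * t + (- ?N n * a)) - E (?N n * t + (- ?N n * b))" for n t
  have \<phi>_alt: "\<phi> n t = E (?N n * (t - a)) - E (?N n * (t - b))" for n t
    by (simp add: \<phi>_def algebra_simps)
  have smooth_\<phi>: "smooth (\<phi> n)" for n
    unfolding \<phi>_def[abs_def] by (intro smooth_diff smooth_affine E)
  have \<phi>_supp: "\<phi> n t = 0" if "t \<notin> {a..b+1}" for n t
  proof (cases "t < a")
    case True
    then have "?N n * (t - a) \<le> 0" "?N n * (t - b) \<le> 0" using \<open>a \<le> b\<close>
      by (auto intro!: mult_nonneg_nonpos)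
    then show ?thesis by (simp add: \<phi>_alt E)
  next
    case False
    then have "1 \<le> t - a" "1 \<le> t - b" using that \<open>a \<le> b\<close> by auto
    then have "1 * 1 \<le> ?N n * (t - a)" "1 * 1 \<le> ?N n * (t - b)" by (intro mult_mono; simp)+
    then show ?thesis by (simp add: \<phi>_alt E)
  qed
  have test: "test_function (\<phi> n)" for n
  proof -
    have "{x. \<phi> n x \<noteq> 0} \<subseteq> {a..b+1}" using \<phi>_supp by blast
    then have "compact (closure {x. \<phi> n x \<noteq> 0})"
      by (meson bounded_closed_interval bounded_subset compact_closure)
    then show ?thesis using smooth_\<phi>[of n] by (simp add: test_function_def smooth_def)
  qed
  have deriv_\<phi>: "deriv (\<phi> n) t = ?N n * deriv E (?N n * (t - a)) - ?N n * deriv E (?N n * (t - b))" for n t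
  proof (rule DERIV_imp_deriv)
    show "(\<phi> n has_real_derivative ?N n * deriv E (?N n * (t - a)) - ?N n * deriv E (?N n * (t - b))) (at t)"
      unfolding \<phi>_alt[abs_def]
      by (auto intro!: derivative_eq_intros DERIV_chain2[OF smooth_has_derivative[OF E(1)]])
  qed
  have cE': "continuous_on A (deriv E)" for A by (intro smooth_continuous_on smooth_deriv E)
  have [measurable]: "u \<in> borel_measurable borel" "deriv E \<in> borel_measurable borel"
      "g' \<in> borel_measurable borel" "\<phi> n \<in> borel_measurable borel" for n
    using u cE' g' smooth_continuous_on[OF smooth_\<phi>] by (auto intro: borel_measurable_continuous_onI)
  have int: "integrable lborel (\<lambda>t. u t * (?N n * deriv E (?N n * (t - c))))" for n c
  proof (rule continuous_compact_support_integrable[of _ c "c + 1"])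
    show "continuous_on UNIV (\<lambda>t. u t * (?N n * deriv E (?N n * (t - c))))"
      by (intro continuous_intros u continuous_on_compose2[OF cE'[of UNIV]]) auto
    fix t assume t: "t \<notin> {c..c + 1}"
    have "?N n * (t - c) < 0 \<or> ?N n * (t - c) > 1"
    proof (cases "t < c")
      case False
      then have "t - c > 1" using t by auto
      then have "1 * 1 < ?N n * (t - c)" by (intro mult_le_less_imp_less) auto
      then show ?thesis by simp
    qed (simp add: mult_pos_neg)
    then show "u t * (?N n * deriv E (?N n * (t - c))) = 0" using E' by auto
  qed
  have "(LINT t|lebesgue. u t * deriv (\<phi> n) t) =
     (LINT t|lborel. u t * (?N n * deriv E (?N n * (t - a)))) -
     (LINT t|lborel. u t * (?N n * deriv E (?N n * (t - b))))" for n
    by (subst Bochner_Integration.integral_diff[symmetric, OF int int])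
       (simp add: deriv_\<phi> integral_lebesgue_eq_lborel right_diff_distrib)
  then have "(\<lambda>n. LINT t|lebesgue. u t * deriv (\<phi> n) t) \<longlonglongrightarrow> u a - u b"
    using tendsto_diff[OF mollifier_tendsto[OF u E E', of a] mollifier_tendsto[OF u E E', of b]]
    by simp
  moreover have "(LINT t|lebesgue. u t * deriv (\<phi> n) t) = - (LINT t|lborel. g' t * \<phi> n t)" for n
  proof -
    have [measurable]: "g \<in> borel_measurable lebesgue"
      using w locally_integrable_measurable by (auto simp: has_weak_derivative_def)
    have [measurable]: "g' \<in> borel_measurable lebesgue" "\<phi> n \<in> borel_measurable lebesgue"
      by (auto intro: lebesgue_measurable_of_borel)
    have "(LINT t|lebesgue. g t * \<phi> n t) = (LINT t|lebesgue. g' t * \<phi> n t)"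
      by (rule integral_cong_AE) (use g'(2) in \<open>auto simp: AE_lebesgue_iff_lborel\<close>)
    then show ?thesis using w test[of n]
      by (simp add: has_weak_derivative_def integral_lebesgue_eq_lborel)
  qed
  moreover have "(\<lambda>n. LINT t|lborel. g' t * \<phi> n t) \<longlonglongrightarrow> (LINT t|lborel. indicator {a..b} t * g' t)"
  proof (rule integral_dominated_convergence[where w = "\<lambda>t. 2 * \<bar>indicator {a..b+1} t *\<^sub>R g' t\<bar>"])
    show "integrable lborel (\<lambda>t. 2 * \<bar>indicator {a..b + 1} t *\<^sub>R g' t\<bar>)"
      using g'(3)[of a "b+1"] by (auto simp: set_integrable_def)
    show "AE t in lborel. norm (g' t * \<phi> n t) \<le> 2 * \<bar>indicator {a..b + 1} t *\<^sub>R g' t\<bar>" for n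
    proof (intro always_eventually allI)
      fix t
      have "\<bar>\<phi> n t\<bar> \<le> 2" using E1[of "?N n * (t - a)"] E1[of "?N n * (t - b)"] unfolding \<phi>_alt by linarith
      then have "\<bar>g' t\<bar> * \<bar>\<phi> n t\<bar> \<le> \<bar>g' t\<bar> * 2" by (intro mult_left_mono) auto
      then show "norm (g' t * \<phi> n t) \<le> 2 * \<bar>indicator {a..b + 1} t *\<^sub>R g' t\<bar>"
        using \<phi>_supp[of t n] by (cases "t \<in> {a..b+1}") (auto simp: abs_mult)
    qed
    have "AE t in lborel. t \<noteq> a" by (rule AE_lborel_singleton)
    then show "AE t in lborel. (\<lambda>n. g' t * \<phi> n t) \<longlonglongrightarrow> indicator {a..b} t * g' t"
    proof eventually_elim
      case (elim t)
      have lim: "\<forall>\<^sub>F n in sequentially. E (?N n * (t - c)) = 1" if "c < t" for c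
        using filterlim_at_top[THEN iffD1, OF tendsto_scaled_at_top[of "t - c"], rule_format, of 1] that
        by (auto elim!: eventually_mono intro: E)
      have lim0: "E (?N n * (t - c)) = 0" if "t \<le> c" for n c
        using that by (intro E(2) mult_nonneg_nonpos) auto
      have "\<forall>\<^sub>F n in sequentially. g' t * \<phi> n t = indicator {a..b} t * g' t"
      proof (cases "t < a")
        case True
        then have "t \<le> a" "t \<le> b" using \<open>a \<le> b\<close> by auto
        then show ?thesis using True lim0 unfolding \<phi>_alt by simp
      next
        case False
        then have "a < t" using elim by simp
        show ?thesis
        proof (cases "t \<le> b")
          case True
          show ?thesis using lim[OF \<open>a < t\<close>] by eventually_elim (use True \<open>a < t\<close> lim0 in \<open>simp add: \<phi>_alt\<close>)
        next
          case False
          then have "b < t" by simp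
          show ?thesis using lim[OF \<open>a < t\<close>] lim[OF \<open>b < t\<close>]
            by eventually_elim (use False in \<open>simp add: \<phi>_alt\<close>)
        qed
      qed
      then show ?case by (rule tendsto_eventually)
    qed
  qed auto
  ultimately have "(\<lambda>n. - (LINT t|lborel. g' t * \<phi> n t)) \<longlonglongrightarrow> u a - u b"
    and "(\<lambda>n. - (LINT t|lborel. g' t * \<phi> n t)) \<longlonglongrightarrow> - (LINT t|lborel. indicator {a..b} t * g' t)"
    by (simp_all only: tendsto_minus)
  from LIMSEQ_unique[OF this] have "u a - u b = - (LINT t|lborel. indicator {a..b} t * g' t)" .
  then show ?thesis by (simp add: set_lebesgue_integral_def)
qed

text \<open>On each \<open>[-n,n]\<close> the Borel sets over which \<open>d\<close> integrates to \<open>0\<close> form a Dynkin system containing the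
half-lines, hence all Borel sets.\<close>

lemma AE_eq_0_if_interval_integrals_0:
  fixes d :: "real \<Rightarrow> real"
  assumes [measurable]: "d \<in> borel_measurable borel"
    and int: "\<And>a b. set_integrable lborel {a..b} d"
    and zero: "\<And>a b. a \<le> b \<Longrightarrow> (LINT x:{a..b}|lborel. d x) = 0"
  shows "AE x in lborel. d x = 0"
proof -
  have "AE x in lborel. indicator {- real n..real n} x *\<^sub>R d x = 0" for n
  proof (rule sigma_finite_measure.density_zero[OF lborel.sigma_finite_measure_axioms])
    let ?d = "\<lambda>x. indicator {- real n..real n} x *\<^sub>R d x"
    show i: "integrable lborel ?d"
      using int by (simp add: set_integrable_def)
    fix A :: "real set" assume "A \<in> sets lborel"
    then have "A \<in> sigma_sets UNIV (range (\<lambda>a. {..a}))"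
      by (simp add: borel_eq_atMost sets_measure_of)
    note A = this
    have IS: "Int_stable (range (\<lambda>a::real. {..a}))" by (auto simp: Int_stable_def)
    have PU: "range (\<lambda>a::real. {..a}) \<subseteq> Pow UNIV" by simp
    from IS PU A show "set_lebesgue_integral lborel A ?d = 0"
    proof (induction A rule: sigma_sets_induct_disjoint)
      case (basic A)
      then obtain a where a: "A = {..a}" by blast
      show ?case
      proof (cases "- real n \<le> min a (real n)")
        case True
        have "set_lebesgue_integral lborel A ?d = (LINT x:{- real n..min a (real n)}|lborel. d x)"
          unfolding set_lebesgue_integral_def a
          by (intro Bochner_Integration.integral_cong) (auto simp: indicator_def)
        then show ?thesis using zero[OF True] by simp
      next
        case False
        then have "indicator A x *\<^sub>R ?d x = 0" for x by (auto simp: a indicator_def)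
        then show ?thesis by (simp only: set_lebesgue_integral_def) simp
      qed
    next
      case (compl A)
      then have A[measurable]: "A \<in> sets borel" by (simp add: borel_eq_atMost sets_measure_of)
      have "set_lebesgue_integral lborel (UNIV - A) ?d = (LINT x|lborel. ?d x - indicator A x *\<^sub>R ?d x)"
        unfolding set_lebesgue_integral_def
        by (intro Bochner_Integration.integral_cong) (auto simp: indicator_def)
      also have "\<dots> = (LINT x|lborel. ?d x) - (LINT x|lborel. indicator A x *\<^sub>R ?d x)"
        by (intro Bochner_Integration.integral_diff i integrable_mult_indicator[OF _ i]) simp
      also have "\<dots> = 0"
        using compl zero[of "- real n" "real n"] by (simp add: set_lebesgue_integral_def)
      finally show ?case .
    next
      case (union A)
      have meas: "A i \<in> sets borel" for i
        using union(2) by (auto simp: borel_eq_atMost sets_measure_of)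
      have "set_integrable lborel (\<Union>i. A i) ?d"
        unfolding set_integrable_def
        by (intro integrable_mult_indicator[OF _ i]) (use meas in auto)
      then have "set_lebesgue_integral lborel (\<Union>i. A i) ?d = (\<Sum>i. set_lebesgue_integral lborel (A i) ?d)"
        using union(1) meas by (intro lebesgue_integral_countable_add) (auto simp: disjoint_family_on_def)
      then show ?case using union by simp
    qed (simp add: set_lebesgue_integral_def)
  qed
  then have "AE x in lborel. \<forall>n. indicator {- real n..real n} x *\<^sub>R d x = 0"
    unfolding AE_all_countable by (rule allI)
  then show ?thesis
  proof eventually_elim
    case (elim x)
    obtain m :: nat where "\<bar>x\<bar> \<le> real m" using real_arch_simple by blast
    then have "x \<in> {- real m..real m}" by auto
    then show ?case using elim[rule_format, of m] by simp
  qed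
qed

lemma weak_derivative_AE_unique:
  assumes u: "continuous_on UNIV u" and w: "has_weak_derivative u g" "has_weak_derivative u h"
  shows "AE x in lborel. g x = h x"
proof -
  obtain g' where g': "g' \<in> borel_measurable borel" "AE x in lborel. g x = g' x"
      "\<And>a b. set_integrable lborel {a..b} g'"
    using locally_integrable_borel_version[of g] w by (auto simp: has_weak_derivative_def)
  obtain h' where h': "h' \<in> borel_measurable borel" "AE x in lborel. h x = h' x"
      "\<And>a b. set_integrable lborel {a..b} h'"
    using locally_integrable_borel_version[of h] w by (auto simp: has_weak_derivative_def)
  have "AE x in lborel. g' x - h' x = 0"
  proof (rule AE_eq_0_if_interval_integrals_0)
    show "(LINT x:{a..b}|lborel. g' x - h' x) = 0" if "a \<le> b" for a b
      using weak_derivative_ftc[OF u w(1) g' that] weak_derivative_ftc[OF u w(2) h' that]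
      by (simp add: set_integral_diff g' h')
  qed (use g' h' in \<open>auto intro: set_integral_diff\<close>)
  with g'(2) h'(2) show ?thesis by eventually_elim simp
qed

section \<open>The Sobolev space through Borel representatives\<close>

lemma test_function_smooth: "test_function \<phi> \<Longrightarrow> smooth \<phi>"
  by (simp add: test_function_def smooth_def)

lemma test_function_support:
  assumes "test_function \<phi>"
  shows "\<exists>r>0. \<forall>x. r \<le> \<bar>x\<bar> \<longrightarrow> \<phi> x = 0 \<and> deriv \<phi> x = 0"
proof -
  have "bounded {x. \<phi> x \<noteq> 0}"
    using assms unfolding test_function_def
    by (auto dest: compact_imp_bounded intro: bounded_subset[OF _ closure_subset])
  then obtain B where B: "\<And>x. \<phi> x \<noteq> 0 \<Longrightarrow> \<bar>x\<bar> \<le> B" by (auto simp: bounded_iff)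
  define r where "r = max B 0 + 1"
  have z: "\<phi> x = 0" if "max B 0 < \<bar>x\<bar>" for x using B[of x] that by force
  have op: "open {x::real. max B 0 < \<bar>x\<bar>}" by (intro open_Collect_less continuous_intros)
  have "deriv \<phi> x = 0" if "r \<le> \<bar>x\<bar>" for x
  proof (rule DERIV_imp_deriv)
    show "(\<phi> has_real_derivative 0) (at x)"
      by (rule has_field_derivative_transform_within_open[OF DERIV_const op])
        (use that z in \<open>auto simp: r_def\<close>)
  qed
  moreover have "r > 0" "\<And>x. r \<le> \<bar>x\<bar> \<Longrightarrow> \<phi> x = 0" by (auto simp: r_def intro!: z)
  ultimately show ?thesis by blast
qed

lemma locally_integrable_mult_compact_support:
  assumes g: "locally_integrable g" and \<psi>: "continuous_on UNIV \<psi>" "\<And>x. r \<le> \<bar>x\<bar> \<Longrightarrow> \<psi> x = 0"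
  shows "integrable lebesgue (\<lambda>x. g x * \<psi> x)"
proof -
  have "bounded (\<psi> ` {-r..r})"
    using \<psi>(1) by (intro compact_imp_bounded compact_continuous_image) (auto intro: continuous_on_subset)
  then obtain B where B: "\<And>x. x \<in> {-r..r} \<Longrightarrow> \<bar>\<psi> x\<bar> \<le> B"
    unfolding bounded_iff by (metis imageI real_norm_def)
  have \<psi>m: "\<psi> \<in> borel_measurable lebesgue"
    using \<psi>(1) by (intro lebesgue_measurable_of_borel borel_measurable_continuous_onI)
  have gi: "integrable lebesgue (\<lambda>x. indicator {-r..r} x *\<^sub>R g x)"
    using g by (simp add: locally_integrable_def set_integrable_def)
  show ?thesis
  proof (rule Bochner_Integration.integrable_bound)
    show "integrable lebesgue (\<lambda>x. B * (indicator {-r..r} x *\<^sub>R g x))"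
      by (intro integrable_mult_right gi)
    show "(\<lambda>x. g x * \<psi> x) \<in> borel_measurable lebesgue"
      by (intro borel_measurable_times locally_integrable_measurable g \<psi>m)
    show "AE x in lebesgue. norm (g x * \<psi> x) \<le> norm (B * (indicator {-r..r} x *\<^sub>R g x))"
    proof (intro always_eventually allI)
      fix x
      show "norm (g x * \<psi> x) \<le> norm (B * (indicator {-r..r} x *\<^sub>R g x))"
      proof (cases "x \<in> {-r..r}")
        case True
        then have "\<bar>g x\<bar> * \<bar>\<psi> x\<bar> \<le> \<bar>g x\<bar> * \<bar>B\<bar>"
          using B[OF True] by (intro mult_left_mono) auto
        then show ?thesis using True by (simp add: abs_mult mult.commute)
      next
        case False
        then have "\<psi> x = 0" by (intro \<psi>(2)) auto
        then show ?thesis by simp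
      qed
    qed
  qed
qed

lemma continuous_locally_integrable: "continuous_on UNIV u \<Longrightarrow> locally_integrable u"
  unfolding locally_integrable_def
  by (auto intro!: absolutely_integrable_continuous_real intro: continuous_on_subset)

text \<open>The product \<open>u \<phi>\<close> vanishes at both ends of an interval containing the support of \<open>\<phi>\<close>, so the integral
of its derivative \<open>g \<phi> + u \<phi>'\<close> is \<open>0\<close>. Finitely many exceptional points do no harm to the fundamental
theorem of calculus for the gauge integral.\<close>

lemma has_weak_derivative_of_derivative:
  assumes u: "continuous_on UNIV u" and S: "finite S"
    and D: "\<And>x. x \<notin> S \<Longrightarrow> (u has_real_derivative g x) (at x)"
    and g: "locally_integrable g"
  shows "has_weak_derivative u g"
  unfolding has_weak_derivative_def
proof (intro conjI allI impI g continuous_locally_integrable u)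
  fix \<phi> assume t: "test_function \<phi>"
  then obtain r where r: "r > 0" and z: "\<And>x. r \<le> \<bar>x\<bar> \<Longrightarrow> \<phi> x = 0"
    and z': "\<And>x. r \<le> \<bar>x\<bar> \<Longrightarrow> deriv \<phi> x = 0"
    using test_function_support by metis
  have \<phi>: "smooth \<phi>" using t by (rule test_function_smooth)
  have c: "continuous_on A \<phi>" "continuous_on A (deriv \<phi>)" for A
    using \<phi> by (auto intro: smooth_continuous_on smooth_deriv)
  have i1: "integrable lebesgue (\<lambda>x. g x * \<phi> x)"
    by (rule locally_integrable_mult_compact_support[OF g c(1) z])
  have i2: "integrable lebesgue (\<lambda>x. u x * deriv \<phi> x)"
    by (rule locally_integrable_mult_compact_support[OF continuous_locally_integrable[OF u] c(2) z'])
  let ?f = "\<lambda>x. g x * \<phi> x + u x * deriv \<phi> x"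
  have i: "integrable lebesgue ?f" by (intro Bochner_Integration.integrable_add i1 i2)
  have f0: "?f x = 0" if "x \<notin> {-r..r}" for x using z[of x] z'[of x] that by auto
  have "(?f has_integral u r * \<phi> r - u (-r) * \<phi> (-r)) {-r..r}"
  proof (rule fundamental_theorem_of_calculus_interior_strong[OF S])
    show "((\<lambda>x. u x * \<phi> x) has_vector_derivative ?f x) (at x)" if "x \<in> {-r<..<r} - S" for x
      unfolding has_real_derivative_iff_has_vector_derivative[symmetric]
      using that by (auto intro!: derivative_eq_intros D smooth_has_derivative[OF \<phi>])
    show "continuous_on {-r..r} (\<lambda>x. u x * \<phi> x)"
      using continuous_on_subset[OF u] c by (intro continuous_intros) auto
  qed (use r in auto)
  then have 1: "integral {-r..r} ?f = 0" using z[of r] z[of "-r"] r by (simp add: integral_unique)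
  have eq: "(\<lambda>x. indicator {-r..r} x *\<^sub>R ?f x) = ?f"
    using f0 by (intro ext) (metis indicator_simps scaleR_zero_left scaleR_one)
  have "set_integrable lebesgue {-r..r} ?f" unfolding set_integrable_def eq by (rule i)
  then have "(LINT x:{-r..r}|lebesgue. ?f x) = 0"
    using 1 by (simp add: set_lebesgue_integral_eq_integral)
  then have "(LINT x|lebesgue. ?f x) = 0" by (simp only: set_lebesgue_integral_def eq)
  then show "(LINT x|lebesgue. u x * deriv \<phi> x) = - (LINT x|lebesgue. g x * \<phi> x)"
    by (simp add: Bochner_Integration.integral_add[OF i1 i2])
qed

lemma has_weak_derivative_lincomb:
  assumes "has_weak_derivative u g" "has_weak_derivative v h"
  shows "has_weak_derivative (\<lambda>x. a * u x + b * v x) (\<lambda>x. a * g x + b * h x)"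
  unfolding has_weak_derivative_def
proof (intro conjI allI impI)
  have li: "locally_integrable u" "locally_integrable v" "locally_integrable g" "locally_integrable h"
    using assms by (auto simp: has_weak_derivative_def)
  have "locally_integrable (\<lambda>x. a * p x + b * q x)" if "locally_integrable p" "locally_integrable q" for p q
    using that unfolding locally_integrable_def
    by (auto intro!: set_integral_add set_integrable_mult_right)
  then show "locally_integrable (\<lambda>x. a * u x + b * v x)" "locally_integrable (\<lambda>x. a * g x + b * h x)"
    using li by auto
  fix \<phi> assume t: "test_function \<phi>"
  then obtain r where r: "r > 0" and z: "\<And>x. r \<le> \<bar>x\<bar> \<Longrightarrow> \<phi> x = 0"
    and z': "\<And>x. r \<le> \<bar>x\<bar> \<Longrightarrow> deriv \<phi> x = 0"
    using test_function_support by metis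
  have \<phi>: "smooth \<phi>" using t by (rule test_function_smooth)
  have c: "continuous_on UNIV \<phi>" "continuous_on UNIV (deriv \<phi>)"
    using \<phi> by (auto intro: smooth_continuous_on smooth_deriv)
  have split: "(LINT x|lebesgue. (a * p x + b * q x) * \<psi> x) =
      a * (LINT x|lebesgue. p x * \<psi> x) + b * (LINT x|lebesgue. q x * \<psi> x)"
    if "integrable lebesgue (\<lambda>x. p x * \<psi> x)" "integrable lebesgue (\<lambda>x. q x * \<psi> x)" for p q \<psi> :: "real \<Rightarrow> real"
  proof -
    have "(LINT x|lebesgue. (a * p x + b * q x) * \<psi> x) =
        (LINT x|lebesgue. a * (p x * \<psi> x) + b * (q x * \<psi> x))"
      by (intro Bochner_Integration.integral_cong) (auto simp: algebra_simps)
    then show ?thesis using that by (simp add: Bochner_Integration.integral_add)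
  qed
  have "(LINT x|lebesgue. u x * deriv \<phi> x) = - (LINT x|lebesgue. g x * \<phi> x)"
    "(LINT x|lebesgue. v x * deriv \<phi> x) = - (LINT x|lebesgue. h x * \<phi> x)"
    using assms t by (auto simp: has_weak_derivative_def)
  then show "(LINT x|lebesgue. (a * u x + b * v x) * deriv \<phi> x) =
      - (LINT x|lebesgue. (a * g x + b * h x) * \<phi> x)"
    using locally_integrable_mult_compact_support[OF li(1) c(2) z']
      locally_integrable_mult_compact_support[OF li(2) c(2) z']
      locally_integrable_mult_compact_support[OF li(3) c(1) z]
      locally_integrable_mult_compact_support[OF li(4) c(1) z]
    by (simp add: split)
qed

lemma has_weak_derivative_cong_AE:
  assumes w: "has_weak_derivative u g" and h: "locally_integrable h" and ae: "AE x in lborel. g x = h x"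
  shows "has_weak_derivative u h"
  unfolding has_weak_derivative_def
proof (intro conjI allI impI h)
  have li: "locally_integrable u" "locally_integrable g"
    using w by (auto simp: has_weak_derivative_def)
  then show "locally_integrable u" by simp
  fix \<phi> assume t: "test_function \<phi>"
  then have "smooth \<phi>" by (rule test_function_smooth)
  then have m: "\<phi> \<in> borel_measurable lebesgue"
    by (intro lebesgue_measurable_of_borel borel_measurable_continuous_onI smooth_continuous_on)
  have "(LINT x|lebesgue. g x * \<phi> x) = (LINT x|lebesgue. h x * \<phi> x)"
  proof (rule integral_cong_AE)
    show "AE x in lebesgue. g x * \<phi> x = h x * \<phi> x"
      unfolding AE_lebesgue_iff_lborel using ae by eventually_elim simp
  qed (intro borel_measurable_times locally_integrable_measurable li h m)+
  then show "(LINT x|lebesgue. u x * deriv \<phi> x) = - (LINT x|lebesgue. h x * \<phi> x)"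
    using w t by (simp add: has_weak_derivative_def)
qed

text \<open>An element of \<open>H\<^sup>1\<close> together with a Borel representative of its weak derivative.\<close>

definition H1_pair :: "(real \<Rightarrow> real) \<Rightarrow> (real \<Rightarrow> real) \<Rightarrow> bool" where
  "H1_pair u g \<longleftrightarrow> continuous_on UNIV u \<and> integrable lborel (\<lambda>x. (u x)\<^sup>2) \<and>
     g \<in> borel_measurable borel \<and> integrable lborel (\<lambda>x. (g x)\<^sup>2) \<and> has_weak_derivative u g"

lemma H1_pair_measurable:
  "H1_pair u g \<Longrightarrow> u \<in> borel_measurable borel" "H1_pair u g \<Longrightarrow> g \<in> borel_measurable borel"
  by (auto simp: H1_pair_def intro: borel_measurable_continuous_onI)

lemma H1_pair_imp_H1:
  assumes "H1_pair u g" shows "u \<in> H1"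
proof -
  note m[measurable] = H1_pair_measurable[OF assms]
  have "square_integrable u" "square_integrable g"
    using assms unfolding square_integrable_def H1_pair_def
    by (auto intro: lebesgue_measurable_of_borel m simp: integrable_lebesgue_eq_lborel)
  then show ?thesis using assms unfolding H1_def H1_pair_def by blast
qed

lemma H1_imp_H1_pair:
  assumes "u \<in> H1" obtains g where "H1_pair u g"
proof -
  obtain g where u: "continuous_on UNIV u" "square_integrable u"
    and g: "has_weak_derivative u g" "square_integrable g" using assms by (auto simp: H1_def)
  then have [measurable]: "u \<in> borel_measurable borel" by (auto intro: borel_measurable_continuous_onI)
  have gm: "g \<in> borel_measurable lebesgue" using g by (simp add: square_integrable_def)
  obtain g' where g': "g' \<in> borel_measurable borel" "AE x in lborel. g x = g' x"
    and li: "\<And>a b. set_integrable lborel {a..b} g'"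
    using locally_integrable_borel_version[of g] g by (auto simp: has_weak_derivative_def)
  note [measurable] = g'(1)
  have "locally_integrable g'"
    using li unfolding locally_integrable_def set_integrable_def
    by (simp add: integrable_lebesgue_eq_lborel)
  then have "has_weak_derivative u g'" using has_weak_derivative_cong_AE[OF g(1) _ g'(2)] by simp
  moreover have "integrable lborel (\<lambda>x. (g' x)\<^sup>2)"
  proof -
    have "integrable lebesgue (\<lambda>x. (g x)\<^sup>2) = integrable lebesgue (\<lambda>x. (g' x)\<^sup>2)"
    proof (rule integrable_cong_AE)
      show "AE x in lebesgue. (g x)\<^sup>2 = (g' x)\<^sup>2"
        unfolding AE_lebesgue_iff_lborel using g'(2) by eventually_elim simp
    qed (intro borel_measurable_power gm lebesgue_measurable_of_borel[OF g'(1)])+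
    then show ?thesis using g(2) by (simp add: square_integrable_def integrable_lebesgue_eq_lborel)
  qed
  ultimately have "H1_pair u g'"
    using u by (simp add: H1_pair_def square_integrable_def integrable_lebesgue_eq_lborel)
  then show ?thesis by (rule that)
qed

lemma H1_pair_locally_integrable:
  assumes "H1_pair u g" shows "set_integrable lborel {a..b} g"
proof -
  note [measurable] = H1_pair_measurable[OF assms]
  have "locally_integrable g" using assms by (simp add: H1_pair_def has_weak_derivative_def)
  then show ?thesis
    unfolding locally_integrable_def set_integrable_def by (simp add: integrable_lebesgue_eq_lborel)
qed

lemma H1_pair_ftc:
  assumes "H1_pair u g" "a \<le> b"
  shows "u b - u a = (LINT x:{a..b}|lborel. g x)"
  using assms(1) H1_pair_locally_integrable[OF assms(1)] H1_pair_measurable[OF assms(1)] assms(2)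
  by (intro weak_derivative_ftc) (auto simp: H1_pair_def)

lemma weak_deriv_AE_eq:
  assumes "H1_pair u g"
  shows "weak_deriv u \<in> borel_measurable lebesgue" "AE x in lborel. weak_deriv u x = g x"
proof -
  have w: "has_weak_derivative u g" using assms by (simp add: H1_pair_def)
  then have s: "has_weak_derivative u (weak_deriv u)" unfolding weak_deriv_def
    using someI[of "has_weak_derivative u" g] by simp
  then show "weak_deriv u \<in> borel_measurable lebesgue"
    by (auto simp: has_weak_derivative_def intro: locally_integrable_measurable)
  show "AE x in lborel. weak_deriv u x = g x"
    using assms by (intro weak_derivative_AE_unique[OF _ s w]) (simp add: H1_pair_def)
qed

lemma integrable_mult_of_squares:
  fixes f g :: "real \<Rightarrow> real"
  assumes "f \<in> borel_measurable borel" "g \<in> borel_measurable borel"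
    and "integrable lborel (\<lambda>x. (f x)\<^sup>2)" "integrable lborel (\<lambda>x. (g x)\<^sup>2)"
  shows "integrable lborel (\<lambda>x. f x * g x)"
proof (rule Bochner_Integration.integrable_bound)
  show "integrable lborel (\<lambda>x. (f x)\<^sup>2 + (g x)\<^sup>2)" using assms by auto
  show "AE x in lborel. norm (f x * g x) \<le> norm ((f x)\<^sup>2 + (g x)\<^sup>2)"
  proof (intro always_eventually allI)
    fix x
    have "\<bar>f x\<bar> * \<bar>g x\<bar> \<le> (f x)\<^sup>2 + (g x)\<^sup>2"
      using sum_squares_bound[of "\<bar>f x\<bar>" "\<bar>g x\<bar>"] mult_nonneg_nonneg[OF abs_ge_zero abs_ge_zero, of "f x" "g x"]
      unfolding power2_abs by linarith
    then show "norm (f x * g x) \<le> norm ((f x)\<^sup>2 + (g x)\<^sup>2)" by (simp add: abs_mult)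
  qed
qed (use assms in auto)

lemma integrable_lincomb_square:
  fixes f g :: "real \<Rightarrow> real"
  assumes "f \<in> borel_measurable borel" "g \<in> borel_measurable borel"
    and "integrable lborel (\<lambda>x. (f x)\<^sup>2)" "integrable lborel (\<lambda>x. (g x)\<^sup>2)"
  shows "integrable lborel (\<lambda>x. (a * f x + b * g x)\<^sup>2)"
proof -
  have "integrable lborel (\<lambda>x. a\<^sup>2 * (f x)\<^sup>2 + 2 * a * b * (f x * g x) + b\<^sup>2 * (g x)\<^sup>2)"
    using integrable_mult_of_squares[OF assms] assms by auto
  moreover have "(\<lambda>x. a\<^sup>2 * (f x)\<^sup>2 + 2 * a * b * (f x * g x) + b\<^sup>2 * (g x)\<^sup>2) = (\<lambda>x. (a * f x + b * g x)\<^sup>2)"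
    by (auto simp: power2_eq_square algebra_simps)
  ultimately show ?thesis by simp
qed

lemma H1_pair_lincomb:
  assumes u: "H1_pair u g" and v: "H1_pair v h"
  shows "H1_pair (\<lambda>x. a * u x + b * v x) (\<lambda>x. a * g x + b * h x)"
proof -
  note m = H1_pair_measurable[OF u] H1_pair_measurable[OF v]
  show ?thesis using assms m integrable_lincomb_square[OF m(1,3)] integrable_lincomb_square[OF m(2,4)]
    has_weak_derivative_lincomb
    unfolding H1_pair_def by (auto intro!: continuous_intros)
qed

text \<open>The form \<open>(u,v)\<^sub>V\<close>, computed from Borel representatives \<open>g\<close>, \<open>h\<close> of the weak derivatives and \<open>W\<close> of the
potential.\<close>

definition energy :: "(real \<Rightarrow> real) \<Rightarrow> (real \<Rightarrow> real) \<Rightarrow> (real \<Rightarrow> real) \<Rightarrow> (real \<Rightarrow> real) \<Rightarrow> (real \<Rightarrow> real) \<Rightarrow> real" where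
  "energy W u g v h = (LINT x|lborel. g x * h x + W x * u x * v x)"

lemma inner_V_eq_energy:
  assumes V: "V \<in> borel_measurable lebesgue" and W: "W \<in> borel_measurable borel"
    and VW: "AE x in lborel. V x = W x"
    and u: "H1_pair u g" and v: "H1_pair v h"
  shows "inner_V V u v = energy W u g v h"
proof -
  note m[measurable] = H1_pair_measurable[OF u] H1_pair_measurable[OF v] W
  have "inner_V V u v = (LINT x|lebesgue. g x * h x + W x * u x * v x)"
    unfolding inner_V_def
  proof (rule integral_cong_AE)
    show "AE x in lebesgue. weak_deriv u x * weak_deriv v x + V x * u x * v x = g x * h x + W x * u x * v x"
      unfolding AE_lebesgue_iff_lborel
      using weak_deriv_AE_eq(2)[OF u] weak_deriv_AE_eq(2)[OF v] VW by eventually_elim simp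
  qed (intro borel_measurable_add borel_measurable_times weak_deriv_AE_eq(1)[OF u]
      weak_deriv_AE_eq(1)[OF v] V m[THEN lebesgue_measurable_of_borel])+
  then show ?thesis by (simp add: integral_lebesgue_eq_lborel energy_def)
qed

section \<open>The fundamental solution for a constant potential\<close>

text \<open>The decaying fundamental solution of \<open>-d\<^sup>2/dx\<^sup>2 + m\<^sup>2\<close>.\<close>

definition kern :: "real \<Rightarrow> real \<Rightarrow> real" where
  "kern m z = exp (- m * \<bar>z\<bar>) / (2 * m)"

text \<open>The derivative of \<open>kern\<close> off the origin. The value \<open>0\<close> at the origin, the mean of the two one-sided
derivatives, makes this an odd function.\<close>

definition kern' :: "real \<Rightarrow> real \<Rightarrow> real" where
  "kern' m z = - sgn z * exp (- m * \<bar>z\<bar>) / 2"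

lemma kern_measurable[measurable]:
  "kern m \<in> borel_measurable borel" "kern' m \<in> borel_measurable borel"
  unfolding kern_def[abs_def] kern'_def[abs_def] by measurable

context
  fixes m :: real
  assumes m: "0 < m"
begin

lemma kern_pos: "0 < kern m z"
  using m by (simp add: kern_def)

lemma kern_le: "kern m z \<le> 1 / (2 * m)"
  using m by (simp add: kern_def divide_right_mono)

lemma kern'_le_kern: "\<bar>kern' m z\<bar> \<le> m * kern m z"
  using m by (simp add: kern_def kern'_def abs_mult abs_sgn_eq)

lemma kern'_le: "\<bar>kern' m z\<bar> \<le> 1 / 2"
  using kern'_le_kern[of z] kern_le[of z] m
    mult_left_mono[OF kern_le[of z], of m] by simp

lemma kern_has_derivative:
  assumes "z \<noteq> 0" shows "(kern m has_real_derivative kern' m z) (at z)"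
proof -
  have *: "(kern m has_real_derivative kern' m z) (at z)"
    if "open S" "z \<in> S" and c: "c = sgn z" "\<And>x. x \<in> S \<Longrightarrow> \<bar>x\<bar> = c * x" for S c
  proof -
    have "((\<lambda>x. exp (- m * (c * x)) / (2 * m)) has_real_derivative
        exp (- m * (c * z)) * (- m * c) / (2 * m)) (at z)"
      using m by (auto intro!: derivative_eq_intros)
    moreover have "exp (- m * (c * z)) * (- m * c) / (2 * m) = kern' m z"
      using m that by (simp add: kern'_def)
    ultimately have "((\<lambda>x. exp (- m * (c * x)) / (2 * m)) has_real_derivative kern' m z) (at z)"
      by simp
    then show ?thesis
      by (rule has_field_derivative_transform_within_open[OF _ that(1,2)]) (simp add: kern_def c(2))
  qed
  show ?thesis
  proof (cases "z > 0")
    case True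
    then show ?thesis by (intro *[of "{0<..}" 1]) auto
  next
    case False
    then show ?thesis using assms by (intro *[of "{..<0}" "-1"]) auto
  qed
qed

lemma exp_neg_Lipschitz: "\<bar>exp (- x) - exp (- y)\<bar> \<le> \<bar>x - y\<bar>" if "0 \<le> x" "0 \<le> y" for x y :: real
proof -
  have *: "exp (- x) - exp (- y) \<le> y - x" if "0 \<le> x" "x \<le> y" for x y :: real
  proof -
    have "exp (- x) - exp (- y) = exp (- x) * (1 - exp (- (y - x)))"
      by (simp add: algebra_simps flip: exp_add)
    also have "\<dots> \<le> 1 * (y - x)"
    proof (rule mult_mono)
      show "1 - exp (- (y - x)) \<le> y - x" using exp_ge_add_one_self[of "- (y - x)"] by linarith
    qed (use that in auto)
    finally show ?thesis by simp
  qed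
  show ?thesis using *[of x y] *[of y x] that by (cases "x \<le> y") auto
qed

lemma kern_Lipschitz: "\<bar>kern m a - kern m b\<bar> \<le> \<bar>a - b\<bar> / 2"
proof -
  have "\<bar>exp (- (m * \<bar>a\<bar>)) - exp (- (m * \<bar>b\<bar>))\<bar> \<le> \<bar>m * \<bar>a\<bar> - m * \<bar>b\<bar>\<bar>"
    using m by (intro exp_neg_Lipschitz) auto
  also have "\<dots> = m * \<bar>\<bar>a\<bar> - \<bar>b\<bar>\<bar>" using m by (simp add: abs_mult flip: right_diff_distrib)
  also have "\<dots> \<le> m * \<bar>a - b\<bar>" using m by (intro mult_left_mono) auto
  finally have "\<bar>exp (- (m * \<bar>a\<bar>)) - exp (- (m * \<bar>b\<bar>))\<bar> / (2 * m) \<le> m * \<bar>a - b\<bar> / (2 * m)"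
    using m by (intro divide_right_mono) auto
  then show ?thesis using m by (simp add: kern_def abs_divide flip: diff_divide_distrib)
qed

lemma kern_even: "kern m (- z) = kern m z" "kern' m (- z) = - kern' m z"
  by (simp_all add: kern_def kern'_def sgn_minus)

lemma kern_nn_integral_right:
  assumes "0 \<le> s"
  shows "(\<integral>\<^sup>+x. ennreal (kern m x) * indicator {s..} x \<partial>lborel) = ennreal (exp (- m * s) / (2 * m\<^sup>2))"
proof -
  have "(\<integral>\<^sup>+x. ennreal (kern m x) * indicator {s..} x \<partial>lborel)
      = (\<integral>\<^sup>+x. ennreal (exp (- m * x) / (2 * m)) * indicator {s..} x \<partial>lborel)"
    using assms by (intro nn_integral_cong) (auto simp: kern_def indicator_def)
  also have "\<dots> = ennreal (0 - (- exp (- m * s) / (2 * m\<^sup>2)))"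
  proof (rule nn_integral_FTC_atLeast)
    show "DERIV (\<lambda>x. - exp (- m * x) / (2 * m\<^sup>2)) x :> exp (- m * x) / (2 * m)" for x
      using m by (auto intro!: derivative_eq_intros simp: power2_eq_square)
    have "LIM x at_top. - m * x :> at_bot"
      using m by (intro filterlim_tendsto_neg_mult_at_bot[OF tendsto_const] filterlim_ident) auto
    then have "((\<lambda>x. - exp (- m * x) / (2 * m\<^sup>2)) \<longlongrightarrow> - 0 / (2 * m\<^sup>2)) at_top"
      using m by (intro tendsto_intros filterlim_compose[OF exp_at_bot]) auto
    then show "((\<lambda>x. - exp (- m * x) / (2 * m\<^sup>2)) \<longlongrightarrow> 0) at_top" by simp
  qed (use m in auto)
  finally show ?thesis by simp
qed

lemma kern_nn_integral_left:
  assumes "s \<le> 0"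
  shows "(\<integral>\<^sup>+x. ennreal (kern m x) * indicator {..s} x \<partial>lborel) = ennreal (exp (m * s) / (2 * m\<^sup>2))"
proof -
  have "(\<integral>\<^sup>+x. ennreal (kern m x) * indicator {..s} x \<partial>lborel)
     = (\<integral>\<^sup>+x. ennreal (kern m x) * indicator {-s..} x \<partial>lborel)"
    by (subst nn_integral_real_affine[of _ "-1" 0])
       (auto simp: kern_even indicator_def intro!: nn_integral_cong)
  then show ?thesis using kern_nn_integral_right[of "-s"] assms by simp
qed

lemma kern_nn_integral: "(\<integral>\<^sup>+x. ennreal (kern m x) \<partial>lborel) = ennreal (1 / m\<^sup>2)"
proof -
  have "(\<integral>\<^sup>+x. ennreal (kern m x) \<partial>lborel) =
      (\<integral>\<^sup>+x. ennreal (kern m x) * indicator {0..} x + ennreal (kern m x) * indicator {..0} x \<partial>lborel)"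
  proof (rule nn_integral_cong_AE)
    have "AE x in lborel. x \<noteq> (0::real)" by (rule AE_lborel_singleton)
    then show "AE x in lborel. ennreal (kern m x) =
        ennreal (kern m x) * indicator {0..} x + ennreal (kern m x) * indicator {..0} x"
      by eventually_elim (auto simp: indicator_def)
  qed
  also have "\<dots> = ennreal (1 / (2 * m\<^sup>2)) + ennreal (1 / (2 * m\<^sup>2))"
    using kern_nn_integral_right[of 0] kern_nn_integral_left[of 0] by (simp add: nn_integral_add)
  also have "\<dots> = ennreal (1 / m\<^sup>2)" by (simp flip: ennreal_plus)
  finally show ?thesis .
qed

lemma kern_nn_integral_shift:
  "(\<integral>\<^sup>+x. ennreal (kern m (x - t)) \<partial>lborel) = ennreal (1 / m\<^sup>2)"
  "(\<integral>\<^sup>+t. ennreal (kern m (x - t)) \<partial>lborel) = ennreal (1 / m\<^sup>2)"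
  using kern_nn_integral
  by (subst nn_integral_real_affine[of _ 1 t], simp_all)
     (subst nn_integral_real_affine[of _ "-1" x], simp_all)

lemma kern_has_integral:
  "has_bochner_integral lborel (\<lambda>x. kern m (x - t)) (1 / m\<^sup>2)"
  by (rule has_bochner_integral_nn_integral)
     (use kern_nn_integral_shift(1)[of t] kern_pos in \<open>auto intro: less_imp_le\<close>)

lemma kern_has_integral_tail:
  "t < s \<Longrightarrow> has_bochner_integral lborel (\<lambda>x. kern m (x - t) * indicator {s..} x) (- kern' m (s - t) / m\<^sup>2)"
  "s < t \<Longrightarrow> has_bochner_integral lborel (\<lambda>x. kern m (x - t) * indicator {..s} x) (kern' m (s - t) / m\<^sup>2)"
proof -
  assume "t < s"
  have "(\<integral>\<^sup>+x. ennreal (kern m (x - t) * indicator {s..} x) \<partial>lborel)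
      = (\<integral>\<^sup>+x. ennreal (kern m x) * indicator {s - t..} x \<partial>lborel)"
    by (subst nn_integral_real_affine[of _ 1 t])
       (auto intro!: nn_integral_cong simp: indicator_def)
  also have "\<dots> = ennreal (- kern' m (s - t) / m\<^sup>2)"
    using \<open>t < s\<close> by (subst kern_nn_integral_right) (auto simp: kern'_def)
  finally show "has_bochner_integral lborel (\<lambda>x. kern m (x - t) * indicator {s..} x) (- kern' m (s - t) / m\<^sup>2)"
    using \<open>t < s\<close>
    by (intro has_bochner_integral_nn_integral)
       (auto intro!: less_imp_le[OF kern_pos] mult_nonneg_nonneg simp: kern'_def)
next
  assume "s < t"
  have "(\<integral>\<^sup>+x. ennreal (kern m (x - t) * indicator {..s} x) \<partial>lborel)
      = (\<integral>\<^sup>+x. ennreal (kern m x) * indicator {..s - t} x \<partial>lborel)"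
    by (subst nn_integral_real_affine[of _ 1 t])
       (auto intro!: nn_integral_cong simp: indicator_def)
  also have "\<dots> = ennreal (kern' m (s - t) / m\<^sup>2)"
    using \<open>s < t\<close> by (subst kern_nn_integral_left) (auto simp: kern'_def algebra_simps)
  finally show "has_bochner_integral lborel (\<lambda>x. kern m (x - t) * indicator {..s} x) (kern' m (s - t) / m\<^sup>2)"
    using \<open>s < t\<close>
    by (intro has_bochner_integral_nn_integral)
       (auto intro!: less_imp_le[OF kern_pos] mult_nonneg_nonneg simp: kern'_def)
qed

lemma kern_square_integrable:
  "integrable lborel (\<lambda>x. (kern m (x - t))\<^sup>2)" "integrable lborel (\<lambda>x. (kern' m (x - t))\<^sup>2)"
proof -
  have i: "integrable lborel (\<lambda>x. kern m (x - t))"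
    using kern_has_integral has_bochner_integral_iff by blast
  have le: "(kern m z)\<^sup>2 \<le> 1 / (2 * m) * kern m z" for z
    using kern_le[of z] kern_pos[of z] unfolding power2_eq_square by (intro mult_right_mono) auto
  show s: "integrable lborel (\<lambda>x. (kern m (x - t))\<^sup>2)"
    by (rule Bochner_Integration.integrable_bound[OF integrable_mult_right[OF i, of "1 / (2 * m)"]])
       (use le kern_pos m in \<open>auto simp: abs_mult less_imp_le\<close>)
  have le': "(kern' m z)\<^sup>2 \<le> m\<^sup>2 * (kern m z)\<^sup>2" for z
    using power_mono[OF kern'_le_kern[of z], of 2] by (simp add: power_mult_distrib)
  show "integrable lborel (\<lambda>x. (kern' m (x - t))\<^sup>2)"
    by (rule Bochner_Integration.integrable_bound[OF integrable_mult_right[OF s, of "m\<^sup>2"]])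
       (use le' in auto)
qed

text \<open>Let \<open>\<Gamma>\<^sub>t\<close> be the kernel centred at \<open>t\<close>. Writing \<open>v(x) - v(t)\<close> as an integral of \<open>g\<close> and exchanging the
order of integration turns \<open>m\<^sup>2 \<integral>\<Gamma>\<^sub>t(x) (v(x) - v(t)) dx\<close> into \<open>\<integral>g(s) (\<plusminus> m\<^sup>2 \<integral>\<Gamma>\<^sub>t) ds\<close>, where the inner
integral runs over the half-line beyond \<open>s\<close> as seen from \<open>t\<close>. With its sign it equals \<open>-\<Gamma>\<^sub>t'(s)\<close>,
because \<open>m\<^sup>2 \<Gamma>\<^sub>t = \<Gamma>\<^sub>t''\<close> off \<open>t\<close>. Since \<open>m\<^sup>2 \<integral>\<Gamma>\<^sub>t = 1\<close>, the term with \<open>v(t)\<close> supplies the right-hand side. No boundary terms at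
infinity have to be discussed.\<close>

lemma kern_reproducing:
  assumes v: "H1_pair v g"
  shows "(LINT x|lborel. kern' m (x - t) * g x + m\<^sup>2 * kern m (x - t) * v x) = v t"
proof -
  note [measurable] = H1_pair_measurable[OF v]
  \<comment> \<open>The signed indicator for which \<open>\<integral>\<sigma>(s,x) g(s) ds = v(x) - v(t)\<close>, whichever of \<open>x\<close> and \<open>t\<close> is larger.\<close>
  define \<sigma> :: "real \<Rightarrow> real \<Rightarrow> real"
    where "\<sigma> s x = (if t < s then indicator {s..} x else if s < t then - indicator {..s} x else 0)" for s x
  have \<sigma>_alt: "\<sigma> s x = (if t < s \<and> s \<le> x then 1 else if s < t \<and> x \<le> s then - 1 else 0)" for s x
    by (auto simp: \<sigma>_def indicator_def)
  have \<sigma>m[measurable]: "(\<lambda>p. \<sigma> (fst p) (snd p)) \<in> borel_measurable (lborel \<Otimes>\<^sub>M lborel)"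
    unfolding \<sigma>_alt by measurable
  have inner: "has_bochner_integral lborel (\<lambda>x. kern m (x - t) * \<sigma> s x) (- kern' m (s - t) / m\<^sup>2)"
    "has_bochner_integral lborel (\<lambda>x. kern m (x - t) * \<bar>\<sigma> s x\<bar>) (\<bar>kern' m (s - t)\<bar> / m\<^sup>2)" for s
  proof -
    consider "t < s" | "s < t" | "s = t" by linarith
    then have "has_bochner_integral lborel (\<lambda>x. kern m (x - t) * \<sigma> s x) (- kern' m (s - t) / m\<^sup>2) \<and>
      has_bochner_integral lborel (\<lambda>x. kern m (x - t) * \<bar>\<sigma> s x\<bar>) (\<bar>kern' m (s - t)\<bar> / m\<^sup>2)"
    proof cases
      case 1
      then have "\<bar>kern' m (s - t)\<bar> = - kern' m (s - t)" by (simp add: kern'_def abs_mult)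
      then show ?thesis using kern_has_integral_tail(1)[OF 1] 1 by (simp add: \<sigma>_def)
    next
      case 2
      then have "\<bar>kern' m (s - t)\<bar> = kern' m (s - t)" by (simp add: kern'_def abs_mult)
      then show ?thesis using kern_has_integral_tail(2)[OF 2]
        has_bochner_integral_minus[OF kern_has_integral_tail(2)[OF 2]] 2 by (simp add: \<sigma>_def)
    next
      case 3
      then show ?thesis by (simp add: \<sigma>_def kern'_def has_bochner_integral_zero)
    qed
    then show "has_bochner_integral lborel (\<lambda>x. kern m (x - t) * \<sigma> s x) (- kern' m (s - t) / m\<^sup>2)"
      "has_bochner_integral lborel (\<lambda>x. kern m (x - t) * \<bar>\<sigma> s x\<bar>) (\<bar>kern' m (s - t)\<bar> / m\<^sup>2)" by auto
  qed
  have sq: "integrable lborel (\<lambda>x. (g x)\<^sup>2)" "integrable lborel (\<lambda>x. (v x)\<^sup>2)"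
    using v by (auto simp: H1_pair_def)
  have k'g: "integrable lborel (\<lambda>x. kern' m (x - t) * g x)"
    by (rule integrable_mult_of_squares) (use kern_square_integrable sq in auto)
  have kv: "integrable lborel (\<lambda>x. kern m (x - t) * v x)"
    by (rule integrable_mult_of_squares) (use kern_square_integrable sq in auto)
  have k: "integrable lborel (\<lambda>x. kern m (x - t))" "(LINT x|lborel. kern m (x - t)) = 1 / m\<^sup>2"
    using kern_has_integral has_bochner_integral_iff by blast+
  have diff: "(LINT s|lborel. \<sigma> s x * g s) = v x - v t" for x
  proof -
    have "AE s in lborel. s \<noteq> t" "AE s in lborel. s \<noteq> x" by (rule AE_lborel_singleton)+
    then have "AE s in lborel. \<sigma> s x * g s = (if t \<le> x then indicator {t..x} s *\<^sub>R g s else - (indicator {x..t} s *\<^sub>R g s))"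
      by eventually_elim (auto simp: \<sigma>_alt indicator_def)
    then have "(LINT s|lborel. \<sigma> s x * g s) =
       (LINT s|lborel. (if t \<le> x then indicator {t..x} s *\<^sub>R g s else - (indicator {x..t} s *\<^sub>R g s)))"
      by (intro integral_cong_AE) (auto simp: \<sigma>_alt)
    also have "\<dots> = v x - v t"
      using H1_pair_ftc[OF v, of t x] H1_pair_ftc[OF v, of x t]
      by (cases "t \<le> x") (auto simp: set_lebesgue_integral_def)
    finally show ?thesis .
  qed
  have int: "integrable (lborel \<Otimes>\<^sub>M lborel) (\<lambda>(s, x). kern m (x - t) * \<sigma> s x * g s)"
  proof (rule lborel_pair.Fubini_integrable)
    show "(\<lambda>(s, x). kern m (x - t) * \<sigma> s x * g s) \<in> borel_measurable (lborel \<Otimes>\<^sub>M lborel)"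
      unfolding split_beta by measurable
    have "(LINT x|lborel. norm (kern m (x - t) * \<sigma> s x * g s)) = \<bar>kern' m (s - t) * g s\<bar> / m\<^sup>2" for s
    proof -
      have "(LINT x|lborel. norm (kern m (x - t) * \<sigma> s x * g s)) =
          (LINT x|lborel. kern m (x - t) * \<bar>\<sigma> s x\<bar> * \<bar>g s\<bar>)"
        by (intro Bochner_Integration.integral_cong) (auto simp: abs_mult abs_of_pos[OF kern_pos])
      also have "\<dots> = \<bar>kern' m (s - t)\<bar> / m\<^sup>2 * \<bar>g s\<bar>"
        using inner(2)[of s] by (simp add: has_bochner_integral_iff)
      finally show ?thesis by (simp add: abs_mult)
    qed
    then show "integrable lborel (\<lambda>s. LINT x|lborel. norm (case (s, x) of (s, x) \<Rightarrow> kern m (x - t) * \<sigma> s x * g s))"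
      using k'g by (simp add: integrable_abs)
    show "AE s in lborel. integrable lborel (\<lambda>x. case (s, x) of (s, x) \<Rightarrow> kern m (x - t) * \<sigma> s x * g s)"
      using inner(1) by (auto simp: has_bochner_integral_iff)
  qed
  have "(LINT x|lborel. (LINT s|lborel. kern m (x - t) * \<sigma> s x * g s)) =
        (LINT s|lborel. (LINT x|lborel. kern m (x - t) * \<sigma> s x * g s))"
    by (rule lborel_pair.Fubini_integral[OF int])
  moreover have "(LINT s|lborel. kern m (x - t) * \<sigma> s x * g s) = kern m (x - t) * (v x - v t)" for x
    using diff[of x] by (simp add: mult.assoc)
  moreover have "(LINT x|lborel. kern m (x - t) * \<sigma> s x * g s) = - (kern' m (s - t) * g s) / m\<^sup>2" for s
    using inner(1)[of s] by (simp add: has_bochner_integral_iff)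
  ultimately have "(LINT x|lborel. kern m (x - t) * v x - kern m (x - t) * v t) =
      - (LINT s|lborel. kern' m (s - t) * g s) / m\<^sup>2"
    by (simp add: right_diff_distrib)
  then have "(LINT x|lborel. kern m (x - t) * v x) - v t / m\<^sup>2 =
      - (LINT s|lborel. kern' m (s - t) * g s) / m\<^sup>2"
    using kv k by (simp add: Bochner_Integration.integral_diff)
  then have "m\<^sup>2 * ((LINT x|lborel. kern m (x - t) * v x) - v t / m\<^sup>2) =
      m\<^sup>2 * (- (LINT s|lborel. kern' m (s - t) * g s) / m\<^sup>2)" by simp
  then have "(LINT s|lborel. kern' m (s - t) * g s) + m\<^sup>2 * (LINT x|lborel. kern m (x - t) * v x) = v t"
    using m by (simp add: right_diff_distrib)
  then show ?thesis using k'g kv by (simp add: mult.assoc)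
qed

end

section \<open>Convolution with the fundamental solution\<close>

definition conv :: "(real \<Rightarrow> real) \<Rightarrow> (real \<Rightarrow> real) \<Rightarrow> real \<Rightarrow> real" where
  "conv k h x = (LINT t|lborel. k (x - t) * h t)"

lemma conv_measurable[measurable]:
  assumes [measurable]: "k \<in> borel_measurable borel" "h \<in> borel_measurable borel"
  shows "conv k h \<in> borel_measurable borel"
  unfolding conv_def[abs_def] by measurable

context
  fixes m :: real
  assumes m: "0 < m"
begin

lemma kern_mult_integrable:
  assumes "integrable lborel h"
  shows "integrable lborel (\<lambda>t. kern m (x - t) * h t)" "integrable lborel (\<lambda>t. kern' m (x - t) * h t)"
proof -
  note [measurable] = borel_measurable_integrable[OF assms]
  have "norm (kern m z * h t) \<le> norm (1 / (2 * m) * h t)" for z t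
    using m kern_le[OF m, of z] kern_pos[OF m, of z] unfolding norm_mult
    by (intro mult_right_mono) auto
  then show "integrable lborel (\<lambda>t. kern m (x - t) * h t)"
    by (intro Bochner_Integration.integrable_bound[OF integrable_mult_right[OF assms, of "1 / (2 * m)"]])
      auto
  have "norm (kern' m z * h t) \<le> norm (1 / 2 * h t)" for z t
    using kern'_le[OF m, of z] unfolding norm_mult by (intro mult_right_mono) auto
  then show "integrable lborel (\<lambda>t. kern' m (x - t) * h t)"
    by (intro Bochner_Integration.integrable_bound[OF integrable_mult_right[OF assms, of "1 / 2"]])
      auto
qed

text \<open>Differentiation under the integral sign is justified by the Lipschitz constant \<open>1/2\<close> of the kernel; the
kink of the kernel affects the single point \<open>t = x\<close>.\<close>

lemma conv_has_derivative:
  assumes h: "integrable lborel h"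
  shows "(conv (kern m) h has_real_derivative conv (kern' m) h x) (at x)"
  unfolding has_field_derivative_iff tendsto_at_iff_sequentially comp_def
proof (intro allI impI)
  note [measurable] = borel_measurable_integrable[OF h]
  fix X :: "nat \<Rightarrow> real" assume X: "\<forall>i. X i \<in> UNIV - {x}" "X \<longlonglongrightarrow> x"
  define q where "q i t = (kern m (X i - t) - kern m (x - t)) / (X i - x) * h t" for i t
  have "(conv (kern m) h (X i) - conv (kern m) h x) / (X i - x) = (LINT t|lborel. q i t)" for i
  proof -
    have "conv (kern m) h (X i) - conv (kern m) h x
        = (LINT t|lborel. kern m (X i - t) * h t - kern m (x - t) * h t)"
      unfolding conv_def by (intro Bochner_Integration.integral_diff[symmetric] kern_mult_integrable h)
    also have "\<dots> / (X i - x) = (LINT t|lborel. q i t)"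
      unfolding integral_divide_zero[symmetric] q_def
      by (intro Bochner_Integration.integral_cong) (auto simp: algebra_simps diff_divide_distrib)
    finally show ?thesis .
  qed
  moreover have "(\<lambda>i. LINT t|lborel. q i t) \<longlonglongrightarrow> conv (kern' m) h x"
    unfolding conv_def
  proof (rule integral_dominated_convergence[where w = "\<lambda>t. 1 / 2 * \<bar>h t\<bar>"])
    show "integrable lborel (\<lambda>t. 1 / 2 * \<bar>h t\<bar>)" using h by auto
    show "q i \<in> borel_measurable lborel" for i unfolding q_def by measurable
    show "AE t in lborel. norm (q i t) \<le> 1 / 2 * \<bar>h t\<bar>" for i
    proof (intro always_eventually allI)
      fix t
      have "\<bar>kern m (X i - t) - kern m (x - t)\<bar> \<le> \<bar>X i - x\<bar> / 2"
        using kern_Lipschitz[OF m, of "X i - t" "x - t"] by simp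
      then have "\<bar>kern m (X i - t) - kern m (x - t)\<bar> / \<bar>X i - x\<bar> \<le> 1 / 2"
        using X(1) by (simp add: divide_le_eq)
      then have "\<bar>kern m (X i - t) - kern m (x - t)\<bar> / \<bar>X i - x\<bar> * \<bar>h t\<bar> \<le> 1 / 2 * \<bar>h t\<bar>"
        by (intro mult_right_mono) auto
      then show "norm (q i t) \<le> 1 / 2 * \<bar>h t\<bar>" by (simp add: q_def abs_mult)
    qed
    have "AE t in lborel. t \<noteq> x" by (rule AE_lborel_singleton)
    then show "AE t in lborel. (\<lambda>i. q i t) \<longlonglongrightarrow> kern' m (x - t) * h t"
    proof eventually_elim
      case (elim t)
      have "((\<lambda>z. kern m (z - t)) has_real_derivative kern' m (x - t) * 1) (at x)"
        by (rule DERIV_chain2[OF kern_has_derivative[OF m]])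
           (use elim in \<open>auto intro!: derivative_eq_intros\<close>)
      then have "(\<lambda>i. (kern m (X i - t) - kern m (x - t)) / (X i - x)) \<longlonglongrightarrow> kern' m (x - t)"
        using X unfolding has_field_derivative_iff tendsto_at_iff_sequentially comp_def by simp
      then show ?case unfolding q_def by (intro tendsto_intros)
    qed
  qed auto
  ultimately show "(\<lambda>i. (conv (kern m) h (X i) - conv (kern m) h x) / (X i - x)) \<longlonglongrightarrow> conv (kern' m) h x"
    by simp
qed

text \<open>The last bound reduces every estimate for the derivative to one for the function itself.\<close>

lemma conv_bounds:
  assumes h: "integrable lborel h" "\<And>t. 0 \<le> h t"
  shows "0 \<le> conv (kern m) h x" "conv (kern m) h x \<le> 1 / (2 * m) * (LINT t|lborel. h t)"
    "\<bar>conv (kern' m) h x\<bar> \<le> m * conv (kern m) h x"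
proof -
  have nn: "0 \<le> kern m z" for z using kern_pos[OF m] by (rule less_imp_le)
  show "0 \<le> conv (kern m) h x" unfolding conv_def using nn h by auto
  have "conv (kern m) h x \<le> (LINT t|lborel. 1 / (2 * m) * h t)"
    unfolding conv_def
    by (intro integral_mono kern_mult_integrable h integrable_mult_right mult_right_mono kern_le m)
  then show "conv (kern m) h x \<le> 1 / (2 * m) * (LINT t|lborel. h t)" by simp
  have "\<bar>conv (kern' m) h x\<bar> \<le> (LINT t|lborel. \<bar>kern' m (x - t) * h t\<bar>)"
    unfolding conv_def by (rule integral_abs_bound)
  also have "\<dots> \<le> (LINT t|lborel. m * (kern m (x - t) * h t))"
  proof (intro integral_mono integrable_abs kern_mult_integrable h integrable_mult_right)
    show "\<bar>kern' m (x - t) * h t\<bar> \<le> m * (kern m (x - t) * h t)" for t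
      using mult_right_mono[OF kern'_le_kern[OF m, of "x - t"] h(2)[of t]] h(2)[of t]
      by (simp add: abs_mult mult.assoc)
  qed
  finally show "\<bar>conv (kern' m) h x\<bar> \<le> m * conv (kern m) h x" by (simp add: conv_def)
qed

lemma conv_square_integrable:
  assumes h: "integrable lborel h" "\<And>t. 0 \<le> h t" and c: "integrable lborel (conv (kern m) h)"
  shows "integrable lborel (\<lambda>x. (conv (kern m) h x)\<^sup>2)" "integrable lborel (\<lambda>x. (conv (kern' m) h x)\<^sup>2)"
proof -
  note [measurable] = borel_measurable_integrable[OF h(1)]
  let ?B = "1 / (2 * m) * (LINT t|lborel. h t)"
  have le: "(conv (kern m) h x)\<^sup>2 \<le> ?B * conv (kern m) h x" for x
    unfolding power2_eq_square using conv_bounds[OF h] by (intro mult_right_mono) auto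
  show s: "integrable lborel (\<lambda>x. (conv (kern m) h x)\<^sup>2)"
    by (rule Bochner_Integration.integrable_bound[OF integrable_mult_right[OF c, of ?B]])
       (use order_trans[OF le abs_ge_self] in auto)
  have le': "(conv (kern' m) h x)\<^sup>2 \<le> m\<^sup>2 * (conv (kern m) h x)\<^sup>2" for x
    using power_mono[OF conv_bounds(3)[OF h], of x 2] by (simp add: power_mult_distrib)
  show "integrable lborel (\<lambda>x. (conv (kern' m) h x)\<^sup>2)"
    by (rule Bochner_Integration.integrable_bound[OF integrable_mult_right[OF s, of "m\<^sup>2"]])
       (use le' in auto)
qed

lemma conv_H1_pair:
  assumes h: "integrable lborel h" "\<And>t. 0 \<le> h t" and c: "integrable lborel (conv (kern m) h)"
  shows "H1_pair (conv (kern m) h) (conv (kern' m) h)"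
  unfolding H1_pair_def
proof (intro conjI conv_square_integrable assms)
  note [measurable] = borel_measurable_integrable[OF h(1)]
  show "continuous_on UNIV (conv (kern m) h)"
    using conv_has_derivative[OF h(1)] DERIV_isCont by (auto intro!: continuous_at_imp_continuous_on)
  show m': "conv (kern' m) h \<in> borel_measurable borel" by measurable
  have "locally_integrable (conv (kern' m) h)"
    unfolding locally_integrable_def set_integrable_def
  proof (intro allI)
    fix a b
    have "integrable lborel (conv (kern' m) h)"
      by (rule Bochner_Integration.integrable_bound[OF integrable_mult_right[OF c, of m]])
         (use order_trans[OF conv_bounds(3)[OF h] abs_ge_self] in auto)
    then have "integrable lborel (\<lambda>x. indicator {a..b} x *\<^sub>R conv (kern' m) h x)"
      by (intro integrable_mult_indicator) auto
    then show "integrable lebesgue (\<lambda>x. indicator {a..b} x *\<^sub>R conv (kern' m) h x)"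
      by (subst integrable_lebesgue_eq_lborel) auto
  qed
  then show "has_weak_derivative (conv (kern m) h) (conv (kern' m) h)"
    using has_weak_derivative_of_derivative[OF \<open>continuous_on UNIV (conv (kern m) h)\<close>, of "{}"]
      conv_has_derivative[OF h(1)] by blast
qed

text \<open>The inner integral of the absolute value is at most \<open>M \<bar>p(x)\<bar> (\<Gamma> * h)(x)\<close>, a product of two
square-integrable functions.\<close>

lemma conv_Fubini:
  assumes h: "integrable lborel h" "\<And>t. 0 \<le> h t" and c: "integrable lborel (conv (kern m) h)"
    and k[measurable]: "k \<in> borel_measurable borel" and kM: "\<And>z. \<bar>k z\<bar> \<le> M * kern m z"
    and p[measurable]: "p \<in> borel_measurable borel" and p2: "integrable lborel (\<lambda>x. (p x)\<^sup>2)"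
  shows "integrable (lborel \<Otimes>\<^sub>M lborel) (\<lambda>(x, t). k (x - t) * p x * h t)"
proof (rule lborel_pair.Fubini_integrable)
  note [measurable] = borel_measurable_integrable[OF h(1)]
  show "(\<lambda>(x, t). k (x - t) * p x * h t) \<in> borel_measurable (lborel \<Otimes>\<^sub>M lborel)"
    unfolding split_beta by measurable
  have le: "\<bar>k (x - t) * p x * h t\<bar> \<le> M * \<bar>p x\<bar> * (kern m (x - t) * h t)" for x t
  proof -
    have "\<bar>k (x - t)\<bar> * (\<bar>p x\<bar> * h t) \<le> M * kern m (x - t) * (\<bar>p x\<bar> * h t)"
      by (intro mult_right_mono kM) (use h(2) in auto)
    then show ?thesis using h(2)[of t] by (simp add: abs_mult ac_simps)
  qed
  have i: "integrable lborel (\<lambda>t. k (x - t) * p x * h t)" for x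
  proof (rule Bochner_Integration.integrable_bound)
    show "integrable lborel (\<lambda>t. M * \<bar>p x\<bar> * (kern m (x - t) * h t))"
      by (intro integrable_mult_right kern_mult_integrable h)
    show "AE t in lborel. norm (k (x - t) * p x * h t) \<le> norm (M * \<bar>p x\<bar> * (kern m (x - t) * h t))"
      using order_trans[OF le abs_ge_self] by simp
  qed measurable
  then show "AE x in lborel. integrable lborel (\<lambda>t. case (x, t) of (x, t) \<Rightarrow> k (x - t) * p x * h t)"
    by simp
  have le2: "(LINT t|lborel. \<bar>k (x - t) * p x * h t\<bar>) \<le> M * (\<bar>p x\<bar> * conv (kern m) h x)" for x
  proof -
    have "(LINT t|lborel. \<bar>k (x - t) * p x * h t\<bar>) \<le> (LINT t|lborel. M * \<bar>p x\<bar> * (kern m (x - t) * h t))"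
      by (intro integral_mono integrable_abs i le integrable_mult_right kern_mult_integrable h)
    then show ?thesis by (simp add: conv_def mult.assoc)
  qed
  have pc: "integrable lborel (\<lambda>x. \<bar>p x\<bar> * conv (kern m) h x)"
    by (rule integrable_mult_of_squares) (use p2 conv_square_integrable[OF h c] in auto)
  show "integrable lborel (\<lambda>x. LINT t|lborel. norm (case (x, t) of (x, t) \<Rightarrow> k (x - t) * p x * h t))"
  proof (rule Bochner_Integration.integrable_bound[OF integrable_mult_right[OF pc, of M]])
    show "(\<lambda>x. LINT t|lborel. norm (case (x, t) of (x, t) \<Rightarrow> k (x - t) * p x * h t)) \<in> borel_measurable lborel"
      by simp
    show "AE x in lborel. norm (LINT t|lborel. norm (case (x, t) of (x, t) \<Rightarrow> k (x - t) * p x * h t))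
        \<le> norm (M * (\<bar>p x\<bar> * conv (kern m) h x))"
      using order_trans[OF le2 abs_ge_self] by (auto simp: abs_of_nonneg)
  qed
qed

text \<open>Superposition of the reproducing identities for the kernels centred at \<open>t\<close> with weights \<open>h(t)\<close>.\<close>

lemma conv_reproducing:
  assumes h: "integrable lborel h" "\<And>t. 0 \<le> h t" and c: "integrable lborel (conv (kern m) h)"
    and v: "H1_pair v g"
  shows "(LINT x|lborel. conv (kern' m) h x * g x + m\<^sup>2 * conv (kern m) h x * v x) = (LINT t|lborel. h t * v t)"
proof -
  note [measurable] = borel_measurable_integrable[OF h(1)] H1_pair_measurable[OF v]
  let ?F = "\<lambda>x t. kern' m (x - t) * g x * h t + m\<^sup>2 * (kern m (x - t) * v x * h t)"
  have sq: "integrable lborel (\<lambda>x. (g x)\<^sup>2)" "integrable lborel (\<lambda>x. (v x)\<^sup>2)"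
    using v by (auto simp: H1_pair_def)
  have "integrable (lborel \<Otimes>\<^sub>M lborel) (\<lambda>(x, t). kern' m (x - t) * g x * h t)"
    by (rule conv_Fubini[OF h c _ kern'_le_kern[OF m] _ sq(1)]) auto
  moreover have "integrable (lborel \<Otimes>\<^sub>M lborel) (\<lambda>(x, t). kern m (x - t) * v x * h t)"
    by (rule conv_Fubini[OF h c, where M = 1]) (use sq less_imp_le[OF kern_pos[OF m]] in auto)
  ultimately have int: "integrable (lborel \<Otimes>\<^sub>M lborel) (\<lambda>(x, t). ?F x t)"
    unfolding split_beta by (intro Bochner_Integration.integrable_add integrable_mult_right)
  have "(LINT x|lborel. conv (kern' m) h x * g x + m\<^sup>2 * conv (kern m) h x * v x)
      = (LINT x|lborel. (LINT t|lborel. ?F x t))"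
  proof (rule Bochner_Integration.integral_cong)
    fix x
    have "(LINT t|lborel. ?F x t) =
        (LINT t|lborel. g x * (kern' m (x - t) * h t) + m\<^sup>2 * v x * (kern m (x - t) * h t))"
      by (intro Bochner_Integration.integral_cong) (auto simp: ac_simps)
    also have "\<dots> = g x * conv (kern' m) h x + m\<^sup>2 * v x * conv (kern m) h x"
      unfolding conv_def using kern_mult_integrable[OF h(1), of x]
      by (subst Bochner_Integration.integral_add) auto
    finally show "conv (kern' m) h x * g x + m\<^sup>2 * conv (kern m) h x * v x = (LINT t|lborel. ?F x t)"
      by (simp add: ac_simps)
  qed simp
  also have "\<dots> = (LINT t|lborel. (LINT x|lborel. ?F x t))"
    by (rule lborel_pair.Fubini_integral[OF int, symmetric])
  also have "\<dots> = (LINT t|lborel. h t * v t)"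
  proof (rule Bochner_Integration.integral_cong)
    fix t
    have "(LINT x|lborel. ?F x t) = (LINT x|lborel. h t * (kern' m (x - t) * g x + m\<^sup>2 * kern m (x - t) * v x))"
      by (intro Bochner_Integration.integral_cong) (auto simp: algebra_simps)
    then show "(LINT x|lborel. ?F x t) = h t * v t" by (simp add: kern_reproducing[OF m v])
  qed simp
  finally show ?thesis .
qed

lemma kern_H1_pair: "H1_pair (\<lambda>x. kern m (x - t)) (\<lambda>x. kern' m (x - t))"
  unfolding H1_pair_def
proof (intro conjI kern_square_integrable m)
  show c: "continuous_on UNIV (\<lambda>x. kern m (x - t))"
    unfolding kern_def using m by (intro continuous_intros) auto
  have D: "((\<lambda>x. kern m (x - t)) has_real_derivative kern' m (x - t)) (at x)" if "x \<notin> {t}" for x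
  proof -
    have "((\<lambda>x. kern m (x - t)) has_real_derivative kern' m (x - t) * 1) (at x)"
      by (rule DERIV_chain2[OF kern_has_derivative[OF m]])
         (use that in \<open>auto intro!: derivative_eq_intros\<close>)
    then show ?thesis by simp
  qed
  have "locally_integrable (\<lambda>x. kern' m (x - t))"
    unfolding locally_integrable_def set_integrable_def
  proof (intro allI)
    fix a b
    have "integrable lborel (\<lambda>x. m * kern m (x - t))"
      using kern_has_integral[OF m] has_bochner_integral_iff by auto
    then have "integrable lborel (\<lambda>x. kern' m (x - t))"
      by (rule Bochner_Integration.integrable_bound)
         (use order_trans[OF kern'_le_kern[OF m] abs_ge_self] in auto)
    then have "integrable lborel (\<lambda>x. indicator {a..b} x *\<^sub>R kern' m (x - t))"
      by (intro integrable_mult_indicator) auto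
    then show "integrable lebesgue (\<lambda>x. indicator {a..b} x *\<^sub>R kern' m (x - t))"
      by (subst integrable_lebesgue_eq_lborel) auto
  qed
  then show "has_weak_derivative (\<lambda>x. kern m (x - t)) (\<lambda>x. kern' m (x - t))"
    by (intro has_weak_derivative_of_derivative[OF c, where S = "{t}"] D) auto
qed measurable

end

section \<open>Construction of the Green function\<close>

text \<open>The potential is taken Borel measurable and within its bounds everywhere; a Lebesgue measurable
potential with the bounds almost everywhere has such a representative.\<close>

locale bounded_potential =
  fixes W :: "real \<Rightarrow> real" and v\<^sub>0 v\<^sub>1 :: real
  assumes W_measurable[measurable]: "W \<in> borel_measurable borel"
    and v\<^sub>0_pos: "0 < v\<^sub>0"
    and W_bounds: "v\<^sub>0 \<le> W x" "W x \<le> v\<^sub>1"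
begin

lemma v\<^sub>0_le_v\<^sub>1: "v\<^sub>0 \<le> v\<^sub>1"
  using W_bounds[of 0] by linarith

lemma v\<^sub>1_pos: "0 < v\<^sub>1"
  using v\<^sub>0_pos v\<^sub>0_le_v\<^sub>1 by linarith

definition m :: real where "m = sqrt v\<^sub>1"

lemma m_pos: "0 < m" and m_square: "m\<^sup>2 = v\<^sub>1"
  using v\<^sub>1_pos by (auto simp: m_def)

text \<open>Picard iteration for \<open>G\<^sub>y = \<Gamma>(\<cdot> - y) + \<Gamma> * ((v\<^sub>1 - W) G\<^sub>y)\<close>. With values in \<open>[0,\<infinity>]\<close> no convergence has to be
known in advance.\<close>

primrec green_approx :: "real \<Rightarrow> nat \<Rightarrow> real \<Rightarrow> ennreal" where
  "green_approx y 0 = (\<lambda>x. 0)"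
| "green_approx y (Suc n) = (\<lambda>x. ennreal (kern m (x - y)) +
     (\<integral>\<^sup>+t. ennreal (kern m (x - t)) * (ennreal (v\<^sub>1 - W t) * green_approx y n t) \<partial>lborel))"

lemma green_approx_measurable[measurable]: "green_approx y n \<in> borel_measurable borel"
proof (induction n)
  case (Suc n)
  note [measurable] = Suc
  show ?case unfolding green_approx.simps by measurable
qed simp

lemma green_approx_mono: "green_approx y n x \<le> green_approx y (Suc n) x"
proof (induction n arbitrary: x)
  case (Suc n)
  then show ?case
    unfolding green_approx.simps(2)[of y "Suc n"] green_approx.simps(2)[of y n]
    by (intro add_left_mono nn_integral_mono mult_left_mono) auto
qed simp

text \<open>The constant \<open>C\<close> is the fixed point of \<open>C = 1/(2m) + (v\<^sub>1 - v\<^sub>0)/v\<^sub>1 \<cdot> C\<close>, the estimate obtained from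
\<open>\<Gamma> \<le> 1/(2m)\<close> and \<open>\<integral>\<Gamma> = 1/v\<^sub>1\<close>.\<close>

lemma green_approx_bound: "green_approx y n x \<le> ennreal (v\<^sub>1 / v\<^sub>0 / (2 * m))"
proof (induction n arbitrary: x)
  case (Suc n)
  let ?C = "v\<^sub>1 / v\<^sub>0 / (2 * m)"
  have C: "0 \<le> ?C" using v\<^sub>0_pos v\<^sub>1_pos m_pos by simp
  have "(\<integral>\<^sup>+t. ennreal (kern m (x - t)) * (ennreal (v\<^sub>1 - W t) * green_approx y n t) \<partial>lborel)
      \<le> (\<integral>\<^sup>+t. ennreal (kern m (x - t)) * ennreal ((v\<^sub>1 - v\<^sub>0) * ?C) \<partial>lborel)"
  proof (intro nn_integral_mono mult_left_mono)
    fix t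
    have "ennreal (v\<^sub>1 - W t) * green_approx y n t \<le> ennreal (v\<^sub>1 - v\<^sub>0) * ennreal ?C"
      using W_bounds[of t] by (intro mult_mono Suc.IH ennreal_leI) auto
    also have "\<dots> = ennreal ((v\<^sub>1 - v\<^sub>0) * ?C)"
      using C v\<^sub>0_le_v\<^sub>1 by (intro ennreal_mult[symmetric]) auto
    finally show "ennreal (v\<^sub>1 - W t) * green_approx y n t \<le> ennreal ((v\<^sub>1 - v\<^sub>0) * ?C)" .
  qed simp
  also have "\<dots> = ennreal (1 / v\<^sub>1) * ennreal ((v\<^sub>1 - v\<^sub>0) * ?C)"
    using kern_nn_integral_shift(2)[OF m_pos, of x]
    by (subst nn_integral_multc) (auto simp: m_square)
  also have "\<dots> = ennreal (1 / v\<^sub>1 * ((v\<^sub>1 - v\<^sub>0) * ?C))"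
    using C v\<^sub>1_pos v\<^sub>0_le_v\<^sub>1 by (intro ennreal_mult[symmetric] mult_nonneg_nonneg) auto
  finally have "green_approx y (Suc n) x \<le> ennreal (1 / (2 * m)) + ennreal (1 / v\<^sub>1 * ((v\<^sub>1 - v\<^sub>0) * ?C))"
    unfolding green_approx.simps by (intro add_mono ennreal_leI kern_le m_pos)
  also have "\<dots> = ennreal (1 / (2 * m) + 1 / v\<^sub>1 * ((v\<^sub>1 - v\<^sub>0) * ?C))"
    using C v\<^sub>1_pos v\<^sub>0_le_v\<^sub>1 m_pos by (intro ennreal_plus[symmetric] mult_nonneg_nonneg) auto
  also have "1 / (2 * m) + 1 / v\<^sub>1 * ((v\<^sub>1 - v\<^sub>0) * ?C) = ?C"
    using v\<^sub>0_pos v\<^sub>1_pos m_pos by (simp add: field_simps)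
  finally show ?case .
qed simp

text \<open>Likewise \<open>1/v\<^sub>0\<close> is the fixed point of \<open>C = 1/v\<^sub>1 + (v\<^sub>1 - v\<^sub>0)/v\<^sub>1 \<cdot> C\<close>.\<close>

lemma green_approx_nn_integral: "(\<integral>\<^sup>+x. green_approx y n x \<partial>lborel) \<le> ennreal (1 / v\<^sub>0)"
proof (induction n)
  case (Suc n)
  let ?q = "\<lambda>t. ennreal (v\<^sub>1 - W t) * green_approx y n t"
  have "(\<integral>\<^sup>+x. (\<integral>\<^sup>+t. ennreal (kern m (x - t)) * ?q t \<partial>lborel) \<partial>lborel)
      = (\<integral>\<^sup>+t. (\<integral>\<^sup>+x. ennreal (kern m (x - t)) * ?q t \<partial>lborel) \<partial>lborel)"
    by (rule lborel_pair.Fubini') measurable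
  also have "\<dots> = (\<integral>\<^sup>+t. ennreal (1 / v\<^sub>1) * ?q t \<partial>lborel)"
    using kern_nn_integral_shift(1)[OF m_pos] by (simp add: nn_integral_multc m_square)
  also have "\<dots> \<le> (\<integral>\<^sup>+t. ennreal (1 / v\<^sub>1) * (ennreal (v\<^sub>1 - v\<^sub>0) * green_approx y n t) \<partial>lborel)"
    using W_bounds by (intro nn_integral_mono mult_left_mono mult_right_mono ennreal_leI) auto
  also have "\<dots> = ennreal (1 / v\<^sub>1) * (ennreal (v\<^sub>1 - v\<^sub>0) * (\<integral>\<^sup>+t. green_approx y n t \<partial>lborel))"
    by (simp add: nn_integral_cmult)
  also have "\<dots> \<le> ennreal (1 / v\<^sub>1) * (ennreal (v\<^sub>1 - v\<^sub>0) * ennreal (1 / v\<^sub>0))"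
    by (intro mult_left_mono Suc.IH) auto
  also have "\<dots> = ennreal (1 / v\<^sub>1 * ((v\<^sub>1 - v\<^sub>0) * (1 / v\<^sub>0)))"
  proof -
    have "0 \<le> 1 / v\<^sub>1" "0 \<le> v\<^sub>1 - v\<^sub>0" "0 \<le> 1 / v\<^sub>0" using v\<^sub>0_pos v\<^sub>1_pos v\<^sub>0_le_v\<^sub>1 by auto
    then show ?thesis by (simp only: ennreal_mult mult_nonneg_nonneg)
  qed
  finally have "(\<integral>\<^sup>+x. green_approx y (Suc n) x \<partial>lborel)
      \<le> ennreal (1 / v\<^sub>1) + ennreal (1 / v\<^sub>1 * ((v\<^sub>1 - v\<^sub>0) * (1 / v\<^sub>0)))"
    using kern_nn_integral_shift(1)[OF m_pos, of y] m_square
    by (simp add: nn_integral_add add_left_mono)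
  also have "\<dots> = ennreal (1 / v\<^sub>1 + 1 / v\<^sub>1 * ((v\<^sub>1 - v\<^sub>0) * (1 / v\<^sub>0)))"
    using v\<^sub>0_pos v\<^sub>1_pos v\<^sub>0_le_v\<^sub>1 by (intro ennreal_plus[symmetric] mult_nonneg_nonneg) auto
  also have "1 / v\<^sub>1 + 1 / v\<^sub>1 * ((v\<^sub>1 - v\<^sub>0) * (1 / v\<^sub>0)) = 1 / v\<^sub>0"
    using v\<^sub>0_pos v\<^sub>1_pos by (simp add: field_simps)
  finally show ?case .
qed simp

definition green_lim :: "real \<Rightarrow> real \<Rightarrow> ennreal" where
  "green_lim y x = (SUP n. green_approx y n x)"

lemma green_lim_measurable[measurable]: "green_lim y \<in> borel_measurable borel"
  unfolding green_lim_def[abs_def] by measurable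

lemma incseq_green_approx: "incseq (\<lambda>n. green_approx y n x)"
  using green_approx_mono by (intro incseq_SucI)

lemma green_lim_bound: "green_lim y x \<le> ennreal (v\<^sub>1 / v\<^sub>0 / (2 * m))"
  unfolding green_lim_def by (intro SUP_least green_approx_bound)

lemma green_lim_nn_integral: "(\<integral>\<^sup>+x. green_lim y x \<partial>lborel) \<le> ennreal (1 / v\<^sub>0)"
proof -
  have "(\<integral>\<^sup>+x. green_lim y x \<partial>lborel) = (SUP n. \<integral>\<^sup>+x. green_approx y n x \<partial>lborel)"
    unfolding green_lim_def
    using incseq_green_approx by (intro nn_integral_monotone_convergence_SUP) (auto simp: incseq_def le_fun_def)
  then show ?thesis using green_approx_nn_integral by (simp add: SUP_least)
qed

lemma green_lim_fixpoint:
  "green_lim y x = ennreal (kern m (x - y)) +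
    (\<integral>\<^sup>+t. ennreal (kern m (x - t)) * (ennreal (v\<^sub>1 - W t) * green_lim y t) \<partial>lborel)"
proof (rule LIMSEQ_unique)
  let ?I = "\<lambda>f. \<integral>\<^sup>+t. ennreal (kern m (x - t)) * (ennreal (v\<^sub>1 - W t) * f t) \<partial>lborel"
  have lim: "(\<lambda>n. green_approx y n x) \<longlonglongrightarrow> green_lim y x" for x
    unfolding green_lim_def by (rule LIMSEQ_SUP[OF incseq_green_approx])
  show "(\<lambda>n. green_approx y (Suc n) x) \<longlonglongrightarrow> green_lim y x"
    by (rule LIMSEQ_Suc[OF lim])
  have inc: "incseq (\<lambda>n t. ennreal (kern m (x - t)) * (ennreal (v\<^sub>1 - W t) * green_approx y n t))"
    using incseq_green_approx unfolding incseq_def le_fun_def by (auto intro!: mult_left_mono)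
  have "?I (green_lim y) = (SUP n. ?I (green_approx y n))"
  proof -
    have "?I (green_lim y) = (\<integral>\<^sup>+t. (SUP n. ennreal (kern m (x - t)) * (ennreal (v\<^sub>1 - W t) * green_approx y n t)) \<partial>lborel)"
      by (simp add: green_lim_def SUP_mult_left_ennreal)
    also have "\<dots> = (SUP n. ?I (green_approx y n))"
      by (rule nn_integral_monotone_convergence_SUP[OF inc]) measurable
    finally show ?thesis .
  qed
  moreover have "incseq (\<lambda>n. ?I (green_approx y n))"
    using inc by (auto simp: incseq_def le_fun_def intro!: nn_integral_mono)
  ultimately have "(\<lambda>n. ?I (green_approx y n)) \<longlonglongrightarrow> ?I (green_lim y)"
    using LIMSEQ_SUP[of "\<lambda>n. ?I (green_approx y n)"] by (simp only:)
  then show "(\<lambda>n. green_approx y (Suc n) x) \<longlonglongrightarrow> ennreal (kern m (x - y)) + ?I (green_lim y)"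
    unfolding green_approx.simps by (intro tendsto_add tendsto_const)
qed

text \<open>The pole is the first argument, so that \<open>green y\<close> is the function \<open>G(\<cdot>,y)\<close>.\<close>

definition green :: "real \<Rightarrow> real \<Rightarrow> real" where
  "green y x = enn2real (green_lim y x)"

text \<open>The right-hand side \<open>(v\<^sub>1 - W) G\<^sub>y\<close> that remains besides \<open>\<delta>\<^sub>y\<close> when \<open>W\<close> is replaced by the constant \<open>v\<^sub>1\<close>.\<close>

definition green_source :: "real \<Rightarrow> real \<Rightarrow> real" where
  "green_source y t = (v\<^sub>1 - W t) * green y t"

definition green' :: "real \<Rightarrow> real \<Rightarrow> real" where
  "green' y x = kern' m (x - y) + conv (kern' m) (green_source y) x"

lemma green_measurable[measurable]: "green y \<in> borel_measurable borel"
  unfolding green_def[abs_def] by measurable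

lemma green_source_measurable[measurable]: "green_source y \<in> borel_measurable borel"
  unfolding green_source_def[abs_def] by measurable

lemma ennreal_green: "ennreal (green y x) = green_lim y x"
proof -
  have "green_lim y x < top" using green_lim_bound[of y x] by (rule order_le_less_trans) simp
  then show ?thesis by (simp add: green_def)
qed

lemma green_nonneg: "0 \<le> green y x"
  by (simp add: green_def)

lemma green_le: "green y x \<le> v\<^sub>1 / v\<^sub>0 / (2 * m)"
  using green_lim_bound[of y x] v\<^sub>0_pos v\<^sub>1_pos m_pos
  by (simp add: ennreal_green[symmetric])

lemma green_integrable: "integrable lborel (green y)"
proof (rule integrableI_bounded)
  have "(\<integral>\<^sup>+x. ennreal (norm (green y x)) \<partial>lborel) = (\<integral>\<^sup>+x. green_lim y x \<partial>lborel)"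
    by (intro nn_integral_cong) (simp add: green_nonneg ennreal_green)
  also have "\<dots> < \<infinity>" using green_lim_nn_integral[of y] by (rule order_le_less_trans) simp
  finally show "(\<integral>\<^sup>+x. ennreal (norm (green y x)) \<partial>lborel) < \<infinity>" .
qed measurable

lemma green_source_nonneg: "0 \<le> green_source y t"
  using W_bounds green_nonneg by (simp add: green_source_def)

lemma green_source_integrable: "integrable lborel (green_source y)"
proof (rule Bochner_Integration.integrable_bound[OF integrable_mult_right[OF green_integrable, of v\<^sub>1]])
  show "AE x in lborel. norm (green_source y x) \<le> norm (v\<^sub>1 * green y x)"
  proof (intro always_eventually allI)
    fix x
    have "0 \<le> W x" using W_bounds(1)[of x] v\<^sub>0_pos by linarith
    then have "\<bar>v\<^sub>1 - W x\<bar> \<le> \<bar>v\<^sub>1\<bar>" using W_bounds(2)[of x] by linarith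
    then show "norm (green_source y x) \<le> norm (v\<^sub>1 * green y x)"
      unfolding green_source_def norm_mult by (intro mult_right_mono) auto
  qed
qed measurable

lemma green_eq: "green y x = kern m (x - y) + conv (kern m) (green_source y) x"
proof -
  have nn: "0 \<le> kern m z" for z using kern_pos[OF m_pos] by (rule less_imp_le)
  have c: "0 \<le> conv (kern m) (green_source y) x"
    by (rule conv_bounds[OF m_pos green_source_integrable green_source_nonneg])
  have "(\<integral>\<^sup>+t. ennreal (kern m (x - t)) * (ennreal (v\<^sub>1 - W t) * green_lim y t) \<partial>lborel)
     = (\<integral>\<^sup>+t. ennreal (kern m (x - t) * green_source y t) \<partial>lborel)"
    using W_bounds(2) green_nonneg nn
    by (intro nn_integral_cong) (simp add: green_source_def ennreal_mult ennreal_green)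
  also have "\<dots> = ennreal (conv (kern m) (green_source y) x)"
    unfolding conv_def
    by (intro nn_integral_eq_integral kern_mult_integrable m_pos green_source_integrable)
       (auto intro!: mult_nonneg_nonneg nn green_source_nonneg)
  finally have "ennreal (green y x) = ennreal (kern m (x - y) + conv (kern m) (green_source y) x)"
    using green_lim_fixpoint[of y x] nn c by (simp add: ennreal_green)
  then show ?thesis using green_nonneg nn c by (subst (asm) ennreal_inj) auto
qed

lemma green_pos: "0 < green y x"
  unfolding green_eq
  using kern_pos[OF m_pos] conv_bounds(1)[OF m_pos green_source_integrable green_source_nonneg]
  by (rule add_pos_nonneg)

lemma conv_green_source_integrable: "integrable lborel (conv (kern m) (green_source y))"
proof -
  have "integrable lborel (\<lambda>x. green y x - kern m (x - y))"
    using green_integrable kern_has_integral[OF m_pos] has_bochner_integral_iff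
    by (intro Bochner_Integration.integrable_diff) blast+
  then show ?thesis by (simp add: green_eq)
qed

lemma green_H1_pair: "H1_pair (green y) (green' y)"
proof -
  have "H1_pair (\<lambda>x. 1 * kern m (x - y) + 1 * conv (kern m) (green_source y) x)
      (\<lambda>x. 1 * kern' m (x - y) + 1 * conv (kern' m) (green_source y) x)"
    by (intro H1_pair_lincomb kern_H1_pair conv_H1_pair m_pos green_source_integrable
        green_source_nonneg conv_green_source_integrable)
  moreover have "green y = (\<lambda>x. 1 * kern m (x - y) + 1 * conv (kern m) (green_source y) x)"
    by (simp add: green_eq fun_eq_iff)
  moreover have "green' y = (\<lambda>x. 1 * kern' m (x - y) + 1 * conv (kern' m) (green_source y) x)"
    by (simp add: green'_def fun_eq_iff)
  ultimately show ?thesis by simp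
qed

lemma energy_integrable:
  assumes "H1_pair u g" "H1_pair v h"
  shows "integrable lborel (\<lambda>x. g x * h x)" "integrable lborel (\<lambda>x. W x * u x * v x)"
proof -
  note m[measurable] = H1_pair_measurable[OF assms(1)] H1_pair_measurable[OF assms(2)]
  show "integrable lborel (\<lambda>x. g x * h x)"
    using assms m by (intro integrable_mult_of_squares) (auto simp: H1_pair_def)
  have uv: "integrable lborel (\<lambda>x. u x * v x)"
    using assms m by (intro integrable_mult_of_squares) (auto simp: H1_pair_def)
  show "integrable lborel (\<lambda>x. W x * u x * v x)"
  proof (rule Bochner_Integration.integrable_bound[OF integrable_mult_right[OF uv, of v\<^sub>1]])
    show "AE x in lborel. norm (W x * u x * v x) \<le> norm (v\<^sub>1 * (u x * v x))"
    proof (intro always_eventually allI)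
      fix x
      have "\<bar>W x\<bar> \<le> \<bar>v\<^sub>1\<bar>" using W_bounds[of x] v\<^sub>0_pos by linarith
      then show "norm (W x * u x * v x) \<le> norm (v\<^sub>1 * (u x * v x))"
        unfolding mult.assoc norm_mult[of "W x"] norm_mult[of v\<^sub>1] by (intro mult_right_mono) auto
    qed
  qed measurable
qed

text \<open>For the constant potential \<open>v\<^sub>1\<close> the two summands of \<open>G\<^sub>y\<close> pair with \<open>v\<close> to \<open>v(y)\<close> and to
\<open>\<integral>(v\<^sub>1 - W) G\<^sub>y v\<close>. Replacing \<open>v\<^sub>1\<close> by \<open>W\<close> subtracts exactly the latter.\<close>

lemma green_reproducing:
  assumes v: "H1_pair v g"
  shows "energy W (green y) (green' y) v g = v y"
proof -
  note [measurable] = H1_pair_measurable[OF v]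
  let ?c = "conv (kern m) (green_source y)" and ?c' = "conv (kern' m) (green_source y)"
  have sq: "integrable lborel (\<lambda>x. (g x)\<^sup>2)" "integrable lborel (\<lambda>x. (v x)\<^sup>2)"
    "integrable lborel (\<lambda>x. (green y x)\<^sup>2)"
    using v green_H1_pair by (auto simp: H1_pair_def)
  have cH: "H1_pair ?c ?c'"
    by (intro conv_H1_pair m_pos green_source_integrable green_source_nonneg conv_green_source_integrable)
  have ik: "integrable lborel (\<lambda>x. kern' m (x - y) * g x + m\<^sup>2 * kern m (x - y) * v x)"
  proof (intro Bochner_Integration.integrable_add)
    show "integrable lborel (\<lambda>x. kern' m (x - y) * g x)"
      by (rule integrable_mult_of_squares) (use sq kern_square_integrable[OF m_pos] in auto)
    have "integrable lborel (\<lambda>x. m\<^sup>2 * (kern m (x - y) * v x))"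
      by (intro integrable_mult_right integrable_mult_of_squares)
         (use sq kern_square_integrable[OF m_pos] in auto)
    then show "integrable lborel (\<lambda>x. m\<^sup>2 * kern m (x - y) * v x)" by (simp add: mult.assoc)
  qed
  have ic: "integrable lborel (\<lambda>x. ?c' x * g x + m\<^sup>2 * ?c x * v x)"
  proof (intro Bochner_Integration.integrable_add)
    show "integrable lborel (\<lambda>x. ?c' x * g x)"
      by (rule integrable_mult_of_squares) (use sq cH in \<open>auto simp: H1_pair_def\<close>)
    have "integrable lborel (\<lambda>x. m\<^sup>2 * (?c x * v x))"
      by (intro integrable_mult_right integrable_mult_of_squares)
         (use sq cH in \<open>auto simp: H1_pair_def\<close>)
    then show "integrable lborel (\<lambda>x. m\<^sup>2 * ?c x * v x)" by (simp add: mult.assoc)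
  qed
  have iv: "integrable lborel (\<lambda>x. green_source y x * v x)"
  proof -
    have "integrable lborel (\<lambda>x. v\<^sub>1 * (green y x * v x))"
      by (intro integrable_mult_right integrable_mult_of_squares sq) auto
    then have "integrable lborel (\<lambda>x. v\<^sub>1 * (green y x * v x) - W x * green y x * v x)"
      using energy_integrable(2)[OF green_H1_pair v] by (rule Bochner_Integration.integrable_diff)
    then show ?thesis by (simp add: green_source_def left_diff_distrib mult.assoc)
  qed
  have "energy W (green y) (green' y) v g = (LINT x|lborel.
      (kern' m (x - y) * g x + m\<^sup>2 * kern m (x - y) * v x) + (?c' x * g x + m\<^sup>2 * ?c x * v x)
      - green_source y x * v x)"
    unfolding energy_def
  proof (intro Bochner_Integration.integral_cong refl)
    fix x
    have gs: "green_source y x = m\<^sup>2 * (kern m (x - y) + ?c x) - W x * green y x"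
      by (simp add: green_source_def m_square left_diff_distrib flip: green_eq)
    show "green' y x * g x + W x * green y x * v x =
      (kern' m (x - y) * g x + m\<^sup>2 * kern m (x - y) * v x) + (?c' x * g x + m\<^sup>2 * ?c x * v x)
      - green_source y x * v x"
      unfolding green'_def gs by (simp only: algebra_simps)
  qed
  also have "\<dots> = v y"
    using ik ic iv
    by (simp add: kern_reproducing[OF m_pos v] conv_reproducing[OF m_pos green_source_integrable
        green_source_nonneg conv_green_source_integrable v])
  finally show ?thesis .
qed

end

section \<open>Derivative jump and maximum principle\<close>

text \<open>The set where the bound fails is open and null, hence empty.\<close>

lemma continuous_AE_le_imp_le:
  fixes f :: "real \<Rightarrow> real"
  assumes "continuous_on UNIV f" "AE x in lborel. f x \<le> c"
  shows "f x \<le> c"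
proof (rule ccontr)
  assume "\<not> f x \<le> c"
  have "open {x. c < f x}" using assms(1) by (intro open_Collect_less continuous_intros)
  moreover have "negligible {x. c < f x}"
  proof -
    have "AE x in lebesgue. \<not> c < f x" unfolding AE_lebesgue_iff_lborel using assms(2) by (simp add: not_less)
    moreover have "{x. c < f x} \<in> sets lebesgue" using \<open>open {x. c < f x}\<close> by (simp add: borel_open)
    ultimately have "{x. c < f x} \<in> null_sets lebesgue"
      by (subst AE_iff_null_sets) auto
    then show ?thesis by (simp add: negligible_iff_null_sets)
  qed
  ultimately have "{x. c < f x} = {}" using open_not_negligible by blast
  moreover have "x \<in> {x. c < f x}" using \<open>\<not> f x \<le> c\<close> by simp
  ultimately show False by blast
qed

lemma left_deriv_eqI:
  assumes "(f has_real_derivative D) (at_left a)" shows "left_deriv f a = D"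
  unfolding left_deriv_def
proof (rule the_equality)
  show "D' = D" if "(f has_real_derivative D') (at_left a)" for D'
    using that assms unfolding has_field_derivative_iff
    by (rule tendsto_unique[OF trivial_limit_at_left_real])
qed fact

lemma right_deriv_eqI:
  assumes "(f has_real_derivative D) (at_right a)" shows "right_deriv f a = D"
  unfolding right_deriv_def
proof (rule the_equality)
  show "D' = D" if "(f has_real_derivative D') (at_right a)" for D'
    using that assms unfolding has_field_derivative_iff
    by (rule tendsto_unique[OF trivial_limit_at_right_real])
qed fact

lemma kern_one_sided_derivative:
  assumes m: "0 < m"
  shows "((\<lambda>x. kern m (x - a)) has_real_derivative 1 / 2) (at_left a)"
    "((\<lambda>x. kern m (x - a)) has_real_derivative - 1 / 2) (at_right a)"
proof -
  have *: "((\<lambda>x. exp (c * (x - a)) / (2 * m)) has_real_derivative c / (2 * m)) (at a within S)" for c S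
    using m by (auto intro!: derivative_eq_intros)
  have "((\<lambda>x. kern m (x - a)) has_real_derivative m / (2 * m)) (at a within {..a})"
    by (rule has_field_derivative_transform_within[OF *[of m], of 1])
       (auto simp: kern_def algebra_simps)
  then show "((\<lambda>x. kern m (x - a)) has_real_derivative 1 / 2) (at_left a)"
    using m by (auto intro: DERIV_subset)
  have "((\<lambda>x. kern m (x - a)) has_real_derivative - m / (2 * m)) (at a within {a..})"
    by (rule has_field_derivative_transform_within[OF *[of "- m"], of 1])
       (auto simp: kern_def algebra_simps)
  then show "((\<lambda>x. kern m (x - a)) has_real_derivative - 1 / 2) (at_right a)"
    using m by (auto intro: DERIV_subset)
qed

text \<open>The piecewise linear function that rises from \<open>0\<close> at \<open>a\<close> to \<open>1\<close> at \<open>p\<close> and falls back to \<open>0\<close> at \<open>b\<close>.\<close>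

definition hat :: "real \<Rightarrow> real \<Rightarrow> real \<Rightarrow> real \<Rightarrow> real" where
  "hat a p b x = max 0 (min ((x - a) / (p - a)) ((b - x) / (b - p)))"

definition hat' :: "real \<Rightarrow> real \<Rightarrow> real \<Rightarrow> real \<Rightarrow> real" where
  "hat' a p b x = 1 / (p - a) * indicator {a..p} x + (- 1 / (b - p)) * indicator {p..b} x"

lemma hat_cases:
  assumes "a < p" "p < b"
  shows "x \<le> a \<Longrightarrow> hat a p b x = 0" "b \<le> x \<Longrightarrow> hat a p b x = 0"
    "a \<le> x \<Longrightarrow> x \<le> p \<Longrightarrow> hat a p b x = (x - a) / (p - a)"
    "p \<le> x \<Longrightarrow> x \<le> b \<Longrightarrow> hat a p b x = (b - x) / (b - p)"
proof -
  have le1: "(x - a) / (p - a) \<le> 1 \<longleftrightarrow> x \<le> p" "(b - x) / (b - p) \<le> 1 \<longleftrightarrow> p \<le> x"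
    using assms by (auto simp: divide_le_eq)
  have ge0: "0 \<le> (x - a) / (p - a) \<longleftrightarrow> a \<le> x" "0 \<le> (b - x) / (b - p) \<longleftrightarrow> x \<le> b"
    using assms by (auto simp: zero_le_divide_iff)
  have le0: "(x - a) / (p - a) \<le> 0 \<longleftrightarrow> x \<le> a" "(b - x) / (b - p) \<le> 0 \<longleftrightarrow> b \<le> x"
    using assms by (auto simp: divide_le_0_iff)
  show "x \<le> a \<Longrightarrow> hat a p b x = 0" "b \<le> x \<Longrightarrow> hat a p b x = 0"
    using le0 by (auto simp: hat_def)
  show "hat a p b x = (x - a) / (p - a)" if "a \<le> x" "x \<le> p"
  proof -
    have "1 \<le> (b - x) / (b - p)" using that assms by (auto simp: le_divide_eq)
    then show ?thesis using le1 ge0 that by (auto simp: hat_def)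
  qed
  show "hat a p b x = (b - x) / (b - p)" if "p \<le> x" "x \<le> b"
  proof -
    have "1 \<le> (x - a) / (p - a)" using that assms by (auto simp: le_divide_eq)
    then show ?thesis using le1 ge0 that by (auto simp: hat_def)
  qed
qed

lemma hat_nonneg: "0 \<le> hat a p b x"
  by (simp add: hat_def)

lemma hat_has_derivative:
  assumes "a < p" "p < b" "x \<notin> {a, p, b}"
  shows "(hat a p b has_real_derivative hat' a p b x) (at x)"
proof -
  note hc = hat_cases[OF assms(1,2)]
  consider "x < a" | "a < x" "x < p" | "p < x" "x < b" | "b < x" using assms by force
  then show ?thesis
  proof cases
    case 1
    have "(hat a p b has_real_derivative 0) (at x)"
      by (rule has_field_derivative_transform_within_open[OF DERIV_const, where S = "{..<a}"])
         (use 1 hc in auto)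
    then show ?thesis using 1 assms by (simp add: hat'_def)
  next
    case 2
    have "((\<lambda>x. (x - a) / (p - a)) has_real_derivative 1 / (p - a)) (at x)"
      using assms by (auto intro!: derivative_eq_intros)
    then have "(hat a p b has_real_derivative 1 / (p - a)) (at x)"
      by (rule has_field_derivative_transform_within_open[where S = "{a<..<p}"])
         (use 2 hc in auto)
    then show ?thesis using 2 assms by (simp add: hat'_def)
  next
    case 3
    have "((\<lambda>x. b - x) has_real_derivative - 1) (at x)" by (auto intro!: derivative_eq_intros)
    then have "((\<lambda>x. (b - x) / (b - p)) has_real_derivative - 1 / (b - p)) (at x)"
      by (rule DERIV_cdivide)
    then have "(hat a p b has_real_derivative - 1 / (b - p)) (at x)"
      by (rule has_field_derivative_transform_within_open[where S = "{p<..<b}"])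
         (use 3 hc in auto)
    then show ?thesis using 3 assms by (simp add: hat'_def)
  next
    case 4
    have "(hat a p b has_real_derivative 0) (at x)"
      by (rule has_field_derivative_transform_within_open[OF DERIV_const, where S = "{b<..}"])
         (use 4 hc in auto)
    then show ?thesis using 4 assms by (simp add: hat'_def)
  qed
qed

lemma hat_H1_pair:
  assumes "a < p" "p < b"
  shows "H1_pair (hat a p b) (hat' a p b)"
  unfolding H1_pair_def
proof (intro conjI)
  show c: "continuous_on UNIV (hat a p b)"
    unfolding hat_def using assms by (intro continuous_intros) auto
  show "integrable lborel (\<lambda>x. (hat a p b x)\<^sup>2)"
    by (rule continuous_compact_support_integrable[of _ a b])
       (use c hat_cases[OF assms] in \<open>auto intro!: continuous_intros\<close>)
  show m[measurable]: "hat' a p b \<in> borel_measurable borel"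
    unfolding hat'_def[abs_def] by measurable
  have ind: "integrable lborel (\<lambda>x. indicator {c..d} x :: real)" for c d :: real
    by (rule integrable_real_indicator) (auto simp: emeasure_lborel_Icc_eq)
  have sq: "(\<lambda>x. (indicator A x)\<^sup>2) = (\<lambda>x. indicator A x :: real)" for A :: "real set"
    by (auto simp: indicator_def)
  show "integrable lborel (\<lambda>x. (hat' a p b x)\<^sup>2)"
    unfolding hat'_def by (rule integrable_lincomb_square) (auto simp: sq ind)
  have "locally_integrable (hat' a p b)"
    unfolding locally_integrable_def set_integrable_def
  proof (intro allI)
    fix c d
    have "integrable lborel (hat' a p b)"
      unfolding hat'_def[abs_def] by (intro Bochner_Integration.integrable_add integrable_mult_right ind)
    then have "integrable lborel (\<lambda>x. indicator {c..d} x *\<^sub>R hat' a p b x)"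
      by (intro integrable_mult_indicator) auto
    then show "integrable lebesgue (\<lambda>x. indicator {c..d} x *\<^sub>R hat' a p b x)"
      by (subst integrable_lebesgue_eq_lborel) auto
  qed
  then show "has_weak_derivative (hat a p b) (hat' a p b)"
    by (intro has_weak_derivative_of_derivative[OF c, where S = "{a, p, b}"] hat_has_derivative assms) auto
qed

context bounded_potential
begin

lemma green_one_sided_derivative:
  "(green y has_real_derivative 1 / 2 + conv (kern' m) (green_source y) y) (at_left y)"
  "(green y has_real_derivative - 1 / 2 + conv (kern' m) (green_source y) y) (at_right y)"
proof -
  have c: "(conv (kern m) (green_source y) has_real_derivative conv (kern' m) (green_source y) y) (at y within S)" for S
    using conv_has_derivative[OF m_pos green_source_integrable] by (rule has_field_derivative_at_within)
  have e: "green y = (\<lambda>x. kern m (x - y) + conv (kern m) (green_source y) x)"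
    by (simp add: green_eq fun_eq_iff)
  show "(green y has_real_derivative 1 / 2 + conv (kern' m) (green_source y) y) (at_left y)"
    by (subst e) (intro DERIV_add kern_one_sided_derivative m_pos c)
  show "(green y has_real_derivative - 1 / 2 + conv (kern' m) (green_source y) y) (at_right y)"
    by (subst e) (intro DERIV_add kern_one_sided_derivative m_pos c)
qed

text \<open>Test the equation with the hat function on \<open>[a,b]\<close>, which vanishes at the pole \<open>y\<close>: the derivative term
is the difference of the two slopes, and the potential term is nonnegative.\<close>

lemma green_convex:
  assumes "a < p" "p < b" and y: "y \<le> a \<or> b \<le> y"
  shows "(green y p - green y a) / (p - a) \<le> (green y b - green y p) / (b - p)"
proof -
  note H = hat_H1_pair[OF assms(1,2)]
  note [measurable] = H1_pair_measurable[OF green_H1_pair] H1_pair_measurable[OF H]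
  have i: "integrable lborel (\<lambda>x. indicator {c..d} x *\<^sub>R green' y x)" for c d
    using H1_pair_locally_integrable[OF green_H1_pair] by (simp add: set_integrable_def)
  have "0 = energy W (green y) (green' y) (hat a p b) (hat' a p b)"
    using y hat_cases[OF assms(1,2)] by (auto simp: green_reproducing[OF H])
  also have "\<dots> = (LINT x|lborel. green' y x * hat' a p b x) + (LINT x|lborel. W x * green y x * hat a p b x)"
    unfolding energy_def
    by (rule Bochner_Integration.integral_add[OF energy_integrable[OF green_H1_pair H]])
  finally have "(LINT x|lborel. green' y x * hat' a p b x) + (LINT x|lborel. W x * green y x * hat a p b x) = 0"
    by simp
  moreover have "0 \<le> (LINT x|lborel. W x * green y x * hat a p b x)"
  proof (rule integral_nonneg_AE, intro always_eventually allI)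
    fix x
    have "0 \<le> W x" using W_bounds(1)[of x] v\<^sub>0_pos by linarith
    then show "0 \<le> W x * green y x * hat a p b x" using green_nonneg hat_nonneg by simp
  qed
  ultimately have "(LINT x|lborel. green' y x * hat' a p b x) \<le> 0" by linarith
  also have "(LINT x|lborel. green' y x * hat' a p b x) =
      (LINT x|lborel. 1 / (p - a) * (indicator {a..p} x *\<^sub>R green' y x)
        + (- 1 / (b - p)) * (indicator {p..b} x *\<^sub>R green' y x))"
    by (intro Bochner_Integration.integral_cong) (auto simp: hat'_def algebra_simps)
  also have "\<dots> = 1 / (p - a) * (LINT x|lborel. indicator {a..p} x *\<^sub>R green' y x)
        + (- 1 / (b - p)) * (LINT x|lborel. indicator {p..b} x *\<^sub>R green' y x)"
    by (simp only: Bochner_Integration.integral_add[OF integrable_mult_right[OF i] integrable_mult_right[OF i]]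
        integral_mult_right_zero)
  also have "(LINT x|lborel. indicator {a..p} x *\<^sub>R green' y x) = green y p - green y a"
    using H1_pair_ftc[OF green_H1_pair, of a p y] assms by (simp add: set_lebesgue_integral_def)
  also have "(LINT x|lborel. indicator {p..b} x *\<^sub>R green' y x) = green y b - green y p"
    using H1_pair_ftc[OF green_H1_pair, of p b y] assms by (simp add: set_lebesgue_integral_def)
  finally show ?thesis by simp
qed

text \<open>If \<open>G\<^sub>y(x) > G\<^sub>y(y)\<close>, convexity propagates the slope between \<open>y\<close> and \<open>x\<close> beyond \<open>x\<close>, and \<open>G\<^sub>y\<close> exceeds its
upper bound \<open>C\<close> at distance \<open>(C + 1) / s\<close> from \<open>x\<close>, where \<open>s\<close> is the absolute slope.\<close>

lemma green_max: "green y x \<le> green y y"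
proof (rule ccontr)
  assume "\<not> green y x \<le> green y y"
  then have gt: "green y y < green y x" and ne: "x \<noteq> y" by auto
  define C where "C = v\<^sub>1 / v\<^sub>0 / (2 * m)"
  have C: "green y z \<le> C" for z unfolding C_def by (rule green_le)
  have C0: "0 \<le> C" using C[of x] green_nonneg[of y x] by linarith
  show False
  proof (cases "y < x")
    case True
    define s where "s = (green y x - green y y) / (x - y)"
    have s: "s > 0" using gt True by (simp add: s_def)
    define b where "b = x + (C + 1) / s"
    have b: "x < b" using s C0 by (simp add: b_def)
    have "s \<le> (green y b - green y x) / (b - x)"
      using green_convex[OF True b, of y] by (simp add: s_def)
    then have "s * (b - x) \<le> green y b - green y x" using b by (simp add: le_divide_eq)
    moreover have "s * (b - x) = C + 1" using s by (simp add: b_def)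
    ultimately show False using C[of b] green_nonneg[of y x] by linarith
  next
    case False
    then have xy: "x < y" using ne by simp
    define s where "s = (green y x - green y y) / (y - x)"
    have s: "s > 0" using gt xy by (simp add: s_def)
    define a where "a = x - (C + 1) / s"
    have a: "a < x" using s C0 by (simp add: a_def)
    have "(green y x - green y a) / (x - a) \<le> - s"
      using green_convex[OF a xy, of y] by (simp add: s_def minus_divide_left)
    then have "green y x - green y a \<le> - s * (x - a)" using a by (simp add: divide_le_eq)
    moreover have "s * (x - a) = C + 1" using s by (simp add: a_def)
    ultimately show False using C[of a] green_nonneg[of y x] by linarith
  qed
qed

end

section \<open>The minimizer\<close>

lemma inner_V_commute: "inner_V V u v = inner_V V v u"
  unfolding inner_V_def by (intro Bochner_Integration.integral_cong) (auto simp: ac_simps)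

locale lebesgue_potential = bounded_potential W v\<^sub>0 v\<^sub>1 for W v\<^sub>0 v\<^sub>1 +
  fixes V :: "real \<Rightarrow> real"
  assumes V_measurable: "V \<in> borel_measurable lebesgue"
    and V_eq_W: "AE x in lborel. V x = W x"
begin

lemma inner_V_eq: "H1_pair u g \<Longrightarrow> H1_pair v h \<Longrightarrow> inner_V V u v = energy W u g v h"
  by (rule inner_V_eq_energy[OF V_measurable W_measurable V_eq_W])

lemma green_in_H1: "green y \<in> H1"
  by (rule H1_pair_imp_H1[OF green_H1_pair])

lemma inner_V_green: "v \<in> H1 \<Longrightarrow> inner_V V (green y) v = v y"
  by (metis H1_imp_H1_pair inner_V_eq green_H1_pair green_reproducing)

lemma is_green_function_green: "is_green_function V (\<lambda>x y. green y x)"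
  unfolding is_green_function_def using green_in_H1 inner_V_green by (simp add: eta_contract_eq)

text \<open>The number \<open>(G(\<cdot>,y), G\<^sub>x)\<^sub>V\<close> is evaluated with the reproducing property of either factor. Applied to the
constructed function this is its symmetry; combined with the symmetry it is uniqueness.\<close>

lemma is_green_function_transpose:
  assumes "is_green_function V G" shows "G x y = green x y"
proof -
  have G: "(\<lambda>x. G x y) \<in> H1" and rep: "\<And>v. v \<in> H1 \<Longrightarrow> inner_V V (\<lambda>x. G x y) v = v y"
    using assms by (auto simp: is_green_function_def)
  have "green x y = inner_V V (\<lambda>x. G x y) (green x)" by (rule rep[OF green_in_H1, symmetric])
  also have "\<dots> = inner_V V (green x) (\<lambda>x. G x y)" by (rule inner_V_commute)
  also have "\<dots> = G x y" by (rule inner_V_green[OF G])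
  finally show ?thesis ..
qed

lemma green_symmetric: "green y x = green x y"
  using is_green_function_transpose[OF is_green_function_green] .

lemma is_green_function_unique: "is_green_function V G \<longleftrightarrow> G = (\<lambda>x y. green y x)"
proof
  assume "is_green_function V G"
  then show "G = (\<lambda>x y. green y x)"
    by (intro ext) (simp add: is_green_function_transpose green_symmetric)
qed (simp add: is_green_function_green)

lemma green_function_eq: "green_function V x y = green y x"
proof -
  have "green_function V = (\<lambda>x y. green y x)"
    unfolding green_function_def by (rule the_equality) (simp_all add: is_green_function_unique)
  then show ?thesis by simp
qed

text \<open>The candidate for the minimizer over \<open>K\<^sub>a\<close>.\<close>

definition norm_green :: "real \<Rightarrow> real \<Rightarrow> real" where
  "norm_green a x = green a x / green a a"

lemma norm_green_H1_pair: "H1_pair (norm_green a) (\<lambda>x. green' a x / green a a)"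
  using H1_pair_lincomb[OF green_H1_pair green_H1_pair, of "1 / green a a" a 0 a]
  by (simp add: norm_green_def[abs_def])

lemma norm_green_at: "norm_green a a = 1"
  using green_pos[of a a] by (simp add: norm_green_def)

lemma energy_norm_green:
  assumes v: "H1_pair v g"
  shows "energy W (norm_green a) (\<lambda>x. green' a x / green a a) v g = v a / green a a"
proof -
  have "energy W (norm_green a) (\<lambda>x. green' a x / green a a) v g
     = (LINT x|lborel. (green' a x * g x + W x * green a x * v x) / green a a)"
    unfolding energy_def norm_green_def by (simp add: add_divide_distrib)
  then show ?thesis using green_reproducing[OF v, of a] by (simp add: energy_def)
qed

lemma norm_green_in_K: "norm_green a \<in> K a"
proof -
  have le: "\<bar>norm_green a x\<bar> \<le> 1" for x
    using green_max[of a x] green_nonneg[of a x] green_pos[of a a] by (simp add: norm_green_def)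
  have c: "continuous_on UNIV (norm_green a)" using norm_green_H1_pair by (auto simp: H1_pair_def)
  have m: "(\<lambda>x. ereal \<bar>norm_green a x\<bar>) \<in> borel_measurable lebesgue"
    using lebesgue_measurable_of_borel[OF borel_measurable_continuous_onI[OF c]] by measurable
  have "esssup lebesgue (\<lambda>x. ereal \<bar>norm_green a x\<bar>) = 1"
  proof (rule antisym)
    show "esssup lebesgue (\<lambda>x. ereal \<bar>norm_green a x\<bar>) \<le> 1"
      using le by (intro esssup_I m) (simp add: one_ereal_def)
    show "1 \<le> esssup lebesgue (\<lambda>x. ereal \<bar>norm_green a x\<bar>)"
    proof (rule ccontr)
      assume "\<not> 1 \<le> esssup lebesgue (\<lambda>x. ereal \<bar>norm_green a x\<bar>)"
      then obtain c where c1: "esssup lebesgue (\<lambda>x. ereal \<bar>norm_green a x\<bar>) < ereal c" "ereal c < 1"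
        using ereal_dense2[of "esssup lebesgue (\<lambda>x. ereal \<bar>norm_green a x\<bar>)" 1] by (auto simp: not_le)
      have "AE x in lebesgue. ereal \<bar>norm_green a x\<bar> \<le> esssup lebesgue (\<lambda>x. ereal \<bar>norm_green a x\<bar>)"
        by (rule esssup_AE)
      then have "AE x in lborel. \<bar>norm_green a x\<bar> \<le> c"
        unfolding AE_lebesgue_iff_lborel
      proof eventually_elim
        case (elim x)
        then have "ereal \<bar>norm_green a x\<bar> < ereal c" using c1(1) by (rule le_less_trans)
        then show ?case by simp
      qed
      then have "\<bar>norm_green a a\<bar> \<le> c"
        by (intro continuous_AE_le_imp_le[where f = "\<lambda>x. \<bar>norm_green a x\<bar>"] continuous_intros c)
      then show False using c1(2) norm_green_at[of a] by (simp add: one_ereal_def)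
    qed
  qed
  then show ?thesis
    using H1_pair_imp_H1[OF norm_green_H1_pair] norm_green_at by (simp add: K_def)
qed

lemma energy_integrand_integrable:
  assumes "H1_pair u g" "H1_pair v h"
  shows "integrable lborel (\<lambda>x. g x * h x + W x * u x * v x)"
  by (rule Bochner_Integration.integrable_add[OF energy_integrable[OF assms]])

lemma energy_diff:
  assumes u: "H1_pair u p" and w: "H1_pair w g"
  shows "energy W (\<lambda>x. w x - u x) (\<lambda>x. g x - p x) (\<lambda>x. w x - u x) (\<lambda>x. g x - p x) =
    energy W w g w g - 2 * energy W u p w g + energy W u p u p"
proof -
  have i: "integrable lborel (\<lambda>x. g x * g x + W x * w x * w x)"
    "integrable lborel (\<lambda>x. 2 * (p x * g x + W x * u x * w x))"
    "integrable lborel (\<lambda>x. p x * p x + W x * u x * u x)"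
    by (intro integrable_mult_right energy_integrand_integrable u w)+
  have "energy W (\<lambda>x. w x - u x) (\<lambda>x. g x - p x) (\<lambda>x. w x - u x) (\<lambda>x. g x - p x) =
     (LINT x|lborel. (g x * g x + W x * w x * w x) - 2 * (p x * g x + W x * u x * w x)
        + (p x * p x + W x * u x * u x))"
    unfolding energy_def by (intro Bochner_Integration.integral_cong) (auto simp: algebra_simps)
  also have "\<dots> = energy W w g w g - 2 * energy W u p w g + energy W u p u p"
    unfolding energy_def
    by (simp only: Bochner_Integration.integral_add[OF Bochner_Integration.integrable_diff[OF i(1,2)] i(3)]
        Bochner_Integration.integral_diff[OF i(1,2)] integral_mult_right_zero)
  finally show ?thesis .
qed

lemma energy_nonneg: "0 \<le> energy W u g u g"
  unfolding energy_def
proof (rule integral_nonneg_AE, intro always_eventually allI)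
  fix x
  have "0 \<le> W x" using W_bounds(1)[of x] v\<^sub>0_pos by linarith
  then show "0 \<le> g x * g x + W x * u x * u x" by (simp add: mult.assoc)
qed

lemma energy_eq_0_imp_0:
  assumes u: "H1_pair u g" and e: "energy W u g u g \<le> 0"
  shows "u x = 0"
proof -
  have i: "integrable lborel (\<lambda>x. g x * g x + W x * u x * u x)"
    by (rule energy_integrand_integrable[OF u u])
  have W0: "0 < W x" for x using W_bounds(1)[of x] v\<^sub>0_pos by linarith
  then have nn: "0 \<le> g x * g x + W x * u x * u x" for x by (simp add: mult.assoc less_imp_le)
  have "energy W u g u g = 0" using e energy_nonneg[of u g] by simp
  then have "AE x in lborel. g x * g x + W x * u x * u x = 0"
    using integral_nonneg_eq_0_iff_AE[OF i] nn by (simp add: energy_def)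
  then have "AE x in lborel. \<bar>u x\<bar> \<le> 0"
  proof eventually_elim
    case (elim x)
    have "0 \<le> g x * g x" "0 \<le> W x * (u x * u x)" using W0[of x] by simp_all
    then have "W x * (u x * u x) = 0" using elim unfolding mult.assoc by linarith
    then show ?case using W0[of x] by simp
  qed
  moreover have "continuous_on UNIV (\<lambda>x. \<bar>u x\<bar>)"
    using u by (intro continuous_intros) (simp add: H1_pair_def)
  ultimately have "\<bar>u x\<bar> \<le> 0" by (intro continuous_AE_le_imp_le[where f = "\<lambda>x. \<bar>u x\<bar>"])
  then show ?thesis by simp
qed

text \<open>Since \<open>(u,w)\<^sub>V = (u,u)\<^sub>V = 1 / G\<^sub>a(a)\<close> for \<open>u = G\<^sub>a / G\<^sub>a(a)\<close> and every \<open>w\<close> with \<open>w(a) = 1\<close>, expanding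
\<open>\<parallel>w - u\<parallel>\<^sup>2\<close> leaves \<open>\<parallel>w\<parallel>\<^sup>2 - \<parallel>u\<parallel>\<^sup>2\<close>, and the form is positive definite.\<close>

lemma norm_green_minimal:
  assumes w: "w \<in> K a"
  shows "inner_V V (norm_green a) (norm_green a) \<le> inner_V V w w"
    and "inner_V V w w \<le> inner_V V (norm_green a) (norm_green a) \<Longrightarrow> w = norm_green a"
proof -
  let ?u = "norm_green a" and ?p = "\<lambda>x. green' a x / green a a"
  have wH: "w \<in> H1" and wa: "w a = 1" using w by (auto simp: K_def)
  obtain g where g: "H1_pair w g" using H1_imp_H1_pair[OF wH] .
  note u = norm_green_H1_pair[of a]
  let ?d = "\<lambda>x. w x - ?u x" and ?q = "\<lambda>x. g x - ?p x"
  have d: "H1_pair ?d ?q" using H1_pair_lincomb[OF g u, of 1 "- 1"] by simp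
  have "energy W ?u ?p w g = 1 / green a a" "energy W ?u ?p ?u ?p = 1 / green a a"
    using energy_norm_green[OF g, of a] energy_norm_green[OF u, of a] by (simp_all add: wa norm_green_at)
  then have eq: "energy W ?d ?q ?d ?q = inner_V V w w - inner_V V ?u ?u"
    using energy_diff[OF u g] by (simp add: inner_V_eq[OF u u] inner_V_eq[OF g g])
  show "inner_V V ?u ?u \<le> inner_V V w w" using eq energy_nonneg[of ?d ?q] by simp
  assume "inner_V V w w \<le> inner_V V ?u ?u"
  then have "energy W ?d ?q ?d ?q \<le> 0" using eq by simp
  from energy_eq_0_imp_0[OF d this] show "w = ?u" by (simp add: fun_eq_iff)
qed

lemma minimizer_eq: "minimizer V a = norm_green a"
  unfolding minimizer_def
proof (rule the_equality)
  show "is_arg_min (\<lambda>w. inner_V V w w) (\<lambda>w. w \<in> K a) (norm_green a)"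
    unfolding is_arg_min_def using norm_green_in_K norm_green_minimal(1) by (auto simp: not_less)
  show "u = norm_green a" if "is_arg_min (\<lambda>w. inner_V V w w) (\<lambda>w. w \<in> K a) u" for u
    using that norm_green_in_K[of a] unfolding is_arg_min_def
    by (intro norm_green_minimal(2)) (auto simp: not_less)
qed

lemma minimizer_derivative_jump:
  "left_deriv (minimizer V a) a - right_deriv (minimizer V a) a = 1 / green a a"
proof -
  let ?c = "conv (kern' m) (green_source a) a"
  have "left_deriv (minimizer V a) a = (1 / 2 + ?c) / green a a"
    unfolding minimizer_eq norm_green_def[abs_def]
    by (intro left_deriv_eqI DERIV_cdivide green_one_sided_derivative)
  moreover have "right_deriv (minimizer V a) a = (- 1 / 2 + ?c) / green a a"
    unfolding minimizer_eq norm_green_def[abs_def]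
    by (intro right_deriv_eqI DERIV_cdivide green_one_sided_derivative)
  ultimately show ?thesis by (simp flip: diff_divide_distrib)
qed

lemma green_eq_minimizer:
  "green y x = minimizer V y x / (left_deriv (minimizer V y) y - right_deriv (minimizer V y) y)"
  using green_pos[of y y] unfolding minimizer_derivative_jump by (simp add: minimizer_eq norm_green_def)

end

lemma borel_representative_of_potential:
  assumes V: "V \<in> borel_measurable lebesgue" and pos: "0 < v\<^sub>0"
    and bounds: "AE x in lebesgue. v\<^sub>0 \<le> V x \<and> V x \<le> v\<^sub>1"
  shows "\<exists>W. lebesgue_potential W v\<^sub>0 v\<^sub>1 V"
proof -
  obtain V' where V': "V' \<in> borel_measurable borel" "AE x in lborel. V x = V' x"
    using completion_ex_borel_measurable_real[OF V] by auto
  note [measurable] = V'(1)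
  have "ae_filter (lebesgue :: real measure) \<noteq> bot" by (simp add: ae_filter_eq_bot_iff)
  from eventually_happens'[OF this bounds] have le: "v\<^sub>0 \<le> v\<^sub>1" by auto
  define W where "W x = max v\<^sub>0 (min v\<^sub>1 (V' x))" for x
  have "AE x in lborel. V x = W x"
    using V'(2) bounds[unfolded AE_lebesgue_iff_lborel] by eventually_elim (auto simp: W_def)
  moreover have "W \<in> borel_measurable borel" unfolding W_def[abs_def] by measurable
  ultimately have "lebesgue_potential W v\<^sub>0 v\<^sub>1 V"
    using V pos le by unfold_locales (auto simp: W_def)
  then show ?thesis by blast
qed

theorem proposition3p2:
  fixes V :: "real \<Rightarrow> real" and v\<^sub>0 v\<^sub>1 :: real
  assumes "V \<in> borel_measurable lebesgue"
    and "0 < v\<^sub>0"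
    and "AE x in lebesgue. v\<^sub>0 \<le> V x \<and> V x \<le> v\<^sub>1"
  shows "(\<exists>!G. is_green_function V G) \<and>
    (\<forall>x y.
      green_function V x y =
        minimizer V y x / (left_deriv (minimizer V y) y - right_deriv (minimizer V y) y) \<and>
      green_function V x y =
        minimizer V x y / (left_deriv (minimizer V x) x - right_deriv (minimizer V x) x))"
proof -
  obtain W where "lebesgue_potential W v\<^sub>0 v\<^sub>1 V"
    using borel_representative_of_potential[OF assms] by blast
  then interpret lebesgue_potential W v\<^sub>0 v\<^sub>1 V .
  have "\<exists>!G. is_green_function V G" by (simp add: is_green_function_unique)
  moreover have "green_function V x y = minimizer V y x / (left_deriv (minimizer V y) y - right_deriv (minimizer V y) y)" for x y
    unfolding green_function_eq by (rule green_eq_minimizer)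
  moreover have "green_function V x y = minimizer V x y / (left_deriv (minimizer V x) x - right_deriv (minimizer V x) x)" for x y
    unfolding green_function_eq green_symmetric[of y x] by (rule green_eq_minimizer)
  ultimately show ?thesis by blast
qed

end
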